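(* Let $k\ge 1$ be a fixed integer. Consider a simple random walk on the complete graph $K_n$ starting at a uniformly random vertex, with trace $\Gamma_t$ after $t$ steps. Let $\tau_C^k=\min\{t:\ \forall v\in[n],\ \mu_t(v)\ge k\}$, where $\mu_t(v)$ is the number of visits to $v$ up to time $t$ (including the starting vertex). For $m\ge1$ let $\tau_\delta^m$ be the first time $t$ at which $\Gamma_t$ is spanning with minimum simple degree at least $m$, and let $\tau_\kappa^m$ be the first time $t$ at which $\Gamma_t$ is spanning and $m$-vertex-connected. Then with high probability $$\tau_C^k=\tau_\delta^{2k-1}=\tau_\kappa^{2k-1}\quad\text{and}\quad \tau_C^k+1=\tau_\delta^{2k}=\tau_\kappa^{2k}.$$
   Context: A simple random walk on $K_n$ (vertex set $[n]$) moves at each step from the current vertex to a uniformly random other vertex, independently of the past. The trace $\Gamma_t$ is the multigraph on $[n]$ whose edges are the edges traversed in the first $t$ steps, with multiplicity. The simple degree of a vertex is its degree in the simple graph obtained by replacing multiple edges by single edges and removing loops; vertex-connectivity refers to this simple graph. "With high probability" means with probability tending to $1$ as $n\to\infty$. *)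

theory Defs
  imports "HOL-Probability.Probability" "HOL-Library.Multiset" "HOL-Library.Extended_Nat"
begin

section \<open>Simple random walk on the complete graph with vertex set [n]\<close>

text \<open>
  The last assumption is the Markov transition rule in product form: conditionally on any history
  \<open>X 0 = x 0, \<dots>, X t = x t\<close>, the next vertex is uniform on the \<open>n - 1\<close> vertices other than
  \<open>x t\<close>.  If the history has probability 0, both sides vanish.
\<close>

locale complete_graph_walk = prob_space M
  for M :: "'a measure" and n :: nat and X :: "nat \<Rightarrow> 'a \<Rightarrow> nat" +
  assumes two_le_n: "2 \<le> n"
    and X_measurable: "\<And>t. X t \<in> measurable M (count_space {1..n})"
    and start_uniform: "\<And>v. v \<in> {1..n} \<Longrightarrow> \<P>(\<omega> in M. X 0 \<omega> = v) = 1 / real n"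
    and step_uniform: "\<And>t x v. v \<in> {1..n} \<Longrightarrow>
      \<P>(\<omega> in M. (\<forall>i\<le>t. X i \<omega> = x i) \<and> X (Suc t) \<omega> = v) =
      \<P>(\<omega> in M. \<forall>i\<le>t. X i \<omega> = x i) * (if v = x t then 0 else 1 / (real n - 1))"

section \<open>Multigraphs on [n]\<close>

text \<open>
  A multigraph on \<open>{1..n}\<close> is given by its multiset of edges; the edge joining \<open>u\<close> and \<open>v\<close> is
  the set \<open>{u, v}\<close>, so that loops are singletons.
\<close>

type_synonym multigraph = "nat set multiset"

definition simple_edges :: "multigraph \<Rightarrow> nat set set" where
  "simple_edges G = {e \<in> set_mset G. card e = 2}"

definition simple_degree :: "multigraph \<Rightarrow> nat \<Rightarrow> nat" where
  "simple_degree G v = card {e \<in> simple_edges G. v \<in> e}"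

definition min_simple_degree :: "nat \<Rightarrow> multigraph \<Rightarrow> nat" where
  "min_simple_degree n G = Min (simple_degree G ` {1..n})"

definition spanning :: "nat \<Rightarrow> multigraph \<Rightarrow> bool" where
  "spanning n G \<longleftrightarrow> {1..n} \<subseteq> \<Union> (set_mset G)"

text \<open>Connectedness of the subgraph induced on \<open>V\<close> by the edge set \<open>E\<close>.\<close>

definition induces_connected :: "nat set \<Rightarrow> nat set set \<Rightarrow> bool" where
  "induces_connected V E \<longleftrightarrow> V \<noteq> {} \<and>
     (\<forall>u\<in>V. \<forall>v\<in>V. (u, v) \<in> {(x, y). x \<in> V \<and> y \<in> V \<and> {x, y} \<in> E}\<^sup>*)"

text \<open>
  The requirement of more than \<open>m\<close> vertices is the usual convention, under which the complete
  graph on \<open>n\<close> vertices has connectivity \<open>n - 1\<close>.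
\<close>

definition vertex_connected :: "nat \<Rightarrow> nat \<Rightarrow> multigraph \<Rightarrow> bool" where
  "vertex_connected n m G \<longleftrightarrow> m < n \<and>
     (\<forall>S \<subseteq> {1..n}. card S < m \<longrightarrow> induces_connected ({1..n} - S) (simple_edges G))"

section \<open>Trace and hitting times of a trajectory\<close>

definition trace :: "(nat \<Rightarrow> nat) \<Rightarrow> nat \<Rightarrow> multigraph" where
  "trace x t = image_mset (\<lambda>i. {x i, x (Suc i)}) (mset_set {..<t})"

definition visits :: "(nat \<Rightarrow> nat) \<Rightarrow> nat \<Rightarrow> nat \<Rightarrow> nat" where
  "visits x t v = card {i. i \<le> t \<and> x i = v}"

text \<open>The value is \<open>\<infinity>\<close> if \<open>P\<close> never holds.\<close>

definition first_time :: "(nat \<Rightarrow> bool) \<Rightarrow> enat" where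
  "first_time P = (INF t \<in> {t. P t}. enat t)"

definition tau_C :: "nat \<Rightarrow> nat \<Rightarrow> (nat \<Rightarrow> nat) \<Rightarrow> enat" where
  "tau_C n k x = first_time (\<lambda>t. \<forall>v\<in>{1..n}. k \<le> visits x t v)"

definition tau_delta :: "nat \<Rightarrow> nat \<Rightarrow> (nat \<Rightarrow> nat) \<Rightarrow> enat" where
  "tau_delta n m x =
     first_time (\<lambda>t. spanning n (trace x t) \<and> m \<le> min_simple_degree n (trace x t))"

definition tau_kappa :: "nat \<Rightarrow> nat \<Rightarrow> (nat \<Rightarrow> nat) \<Rightarrow> enat" where
  "tau_kappa n m x =
     first_time (\<lambda>t. spanning n (trace x t) \<and> vertex_connected n m (trace x t))"

end

(*
  Each visit to a vertex contributes at most two edges, which gives the lower bounds on the hitting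
  times of degree and connectivity. For the upper bounds, suppose that the trace is not sufficiently
  connected at time tau_C^k (or one step later). Then there are disjoint vertex sets A and S, with S
  small and A at most half of the remaining vertices, such that the walk never used an edge between A
  and the complement of A and S, although every vertex of A was visited at least k times.

  For fixed A and S this is bounded by a supermartingale: the weight z^(visits to A) h(X_t), killed as
  soon as a forbidden edge is used, decays like (1 - |A|/n)^t for a suitable function h that is
  constant on A, on S and on the rest. Since tau_C^k exceeds u = (1 - eps) n ln n with high probability
  (second moment method), the maximal inequality from time u on and a union bound over A and S suffice.
  The parameter z has to be of order n^2 for singletons, where every visit to A costs an entry from S
  and an exit to S, of order n / |A| for small A, and can be 1 as soon as |A| is at least a small
  power of n.
*)

theory Submission
  imports Defs "HOL-Real_Asymp.Real_Asymp"
begin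

section \<open>Functionals of finite histories\<close>

text \<open>The sizes of z come from an exponent count. There are about n^(|A|+|S|) candidate pairs,
  and the decay up to time u contributes roughly n^(-|A|), up to a small power. For a singleton this
  cancels the choice of A, and n^|S| must be beaten by the edges into S: k visits have k entries and
  k exits, each costing O(1/n). At time tau_C the walk may still sit on the vertex, so one exit may
  be missing and the cost is only n^-(2k-1), which suffices for |S| <= 2k-2. Once the vertex has
  been left the cost is n^(-2k), which suffices for |S| <= 2k-1. This one unit is the difference
  between the two halves of the theorem. For |A| >= 2 a cost of about |A|/n per visit is enough,
  because k|A| >= 2k exceeds 2k-1. When |A| is a power of n, the loss n^(eps |A|) in the decay
  becomes the main danger, and the factorial in the binomial coefficient repays it. The random time
  tau_C is controlled only from below: the maximal inequality treats all times from u on at once, so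
  no upper bound on tau_C enters.\<close>

definition adapted :: "nat \<Rightarrow> ((nat \<Rightarrow> nat) \<Rightarrow> 'b) \<Rightarrow> bool" where
  "adapted t F \<longleftrightarrow> (\<forall>x y. (\<forall>i\<le>t. x i = y i) \<longrightarrow> F x = F y)"

lemma adaptedD: "adapted t F \<Longrightarrow> (\<And>i. i \<le> t \<Longrightarrow> x i = y i) \<Longrightarrow> F x = F y"
  unfolding adapted_def by blast

lemma adaptedI: "(\<And>x y. (\<And>i. i \<le> t \<Longrightarrow> x i = y i) \<Longrightarrow> F x = F y) \<Longrightarrow> adapted t F"
  unfolding adapted_def by blast

lemma adapted_mono: "adapted t F \<Longrightarrow> t \<le> u \<Longrightarrow> adapted u F"
  unfolding adapted_def by (meson order_trans)

lemma adapted_comp2: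
  assumes "adapted t F" "adapted t G"
  shows "adapted t (\<lambda>x. f (F x) (G x))"
  by (rule adaptedI) (metis adaptedD[OF assms(1)] adaptedD[OF assms(2)])

lemma adapted_comp:
  assumes "adapted t F"
  shows "adapted t (\<lambda>x. f (F x))"
  by (rule adaptedI) (metis adaptedD[OF assms(1)])

section \<open>Expectations over finite histories, and supermartingale decay\<close>

context complete_graph_walk
begin

abbreviation path :: "'a \<Rightarrow> nat \<Rightarrow> nat" where
  "path \<omega> \<equiv> \<lambda>t. X t \<omega>"

definition cylinder :: "nat \<Rightarrow> (nat \<Rightarrow> nat) \<Rightarrow> 'a set" where
  "cylinder t p = {\<omega> \<in> space M. \<forall>i\<le>t. X i \<omega> = p i}"

text \<open>Extensional functions give each history exactly one representative, so the space is a
  disjoint union of finitely many cylinders.\<close>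

definition paths :: "nat \<Rightarrow> (nat \<Rightarrow> nat) set" where
  "paths t = PiE {..t} (\<lambda>_. {1..n})"

lemma X_range: "\<omega> \<in> space M \<Longrightarrow> X t \<omega> \<in> {1..n}"
  using measurable_space[OF X_measurable] by auto

lemma finite_paths: "finite (paths t)"
  unfolding paths_def by (intro finite_PiE) auto

lemma cylinder_sets: "cylinder t p \<in> sets M"
proof -
  have "{\<omega> \<in> space M. X i \<omega> = p i} \<in> sets M" for i
  proof -
    have "{\<omega> \<in> space M. X i \<omega> = p i} = X i -` ({p i} \<inter> {1..n}) \<inter> space M"
      using X_range by blast
    then show ?thesis using measurable_sets[OF X_measurable, of "{p i} \<inter> {1..n}" i] by simp
  qed
  then show ?thesis
    unfolding cylinder_def atMost_iff[symmetric] Ball_def[symmetric]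
    by (intro sets.sets_Collect_finite_All) auto
qed

lemma restrict_path: "\<omega> \<in> space M \<Longrightarrow> restrict (path \<omega>) {..t} \<in> paths t"
  using X_range unfolding paths_def by auto

lemma mem_cylinder_iff:
  assumes "\<omega> \<in> space M" "p \<in> paths t"
  shows "\<omega> \<in> cylinder t p \<longleftrightarrow> p = restrict (path \<omega>) {..t}"
  using assms unfolding cylinder_def paths_def
  by (auto simp: restrict_def fun_eq_iff PiE_def extensional_def)

lemma adapted_sets:
  assumes "adapted t Q"
  shows "{\<omega> \<in> space M. Q (path \<omega>)} \<in> sets M"
proof -
  have Q: "Q (path \<omega>) = Q (restrict (path \<omega>) {..t})" for \<omega>
    by (rule adaptedD[OF assms]) auto
  have "{\<omega> \<in> space M. Q (path \<omega>)} = (\<Union>p\<in>{p \<in> paths t. Q p}. cylinder t p)"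
    using Q mem_cylinder_iff restrict_path by (auto simp: cylinder_def)
  also have "\<dots> \<in> sets M"
    using finite_paths cylinder_sets by (intro sets.finite_UN) auto
  finally show ?thesis .
qed

lemma adapted_eq_sum:
  fixes F :: "(nat \<Rightarrow> nat) \<Rightarrow> real"
  assumes "adapted t F" "\<omega> \<in> space M"
  shows "F (path \<omega>) = (\<Sum>p\<in>paths t. F p * indicator (cylinder t p) \<omega>)"
proof -
  have Q: "F (path \<omega>) = F (restrict (path \<omega>) {..t})"
    by (rule adaptedD[OF assms(1)]) auto
  have "(\<Sum>p\<in>paths t. F p * indicator (cylinder t p) \<omega>)
      = (\<Sum>p\<in>paths t. if p = restrict (path \<omega>) {..t} then F p else 0)"
    using mem_cylinder_iff[OF assms(2)] by (intro sum.cong) (auto simp: indicator_def)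
  also have "\<dots> = F (restrict (path \<omega>) {..t})"
    using restrict_path[OF assms(2)] finite_paths by simp
  finally show ?thesis using Q by simp
qed

lemma integrable_adapted:
  fixes F :: "(nat \<Rightarrow> nat) \<Rightarrow> real"
  assumes "adapted t F"
  shows "integrable M (\<lambda>\<omega>. F (path \<omega>))"
proof -
  have "integrable M (\<lambda>\<omega>. \<Sum>p\<in>paths t. F p * indicator (cylinder t p) \<omega>)"
    using cylinder_sets by (intro Bochner_Integration.integrable_sum integrable_mult_right integrable_real_indicator)
      (auto simp: less_top[symmetric])
  then show ?thesis
    using adapted_eq_sum[OF assms] by (simp cong: Bochner_Integration.integrable_cong)
qed

lemma expectation_adapted:
  fixes F :: "(nat \<Rightarrow> nat) \<Rightarrow> real"
  assumes "adapted t F"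
  shows "expectation (\<lambda>\<omega>. F (path \<omega>)) = (\<Sum>p\<in>paths t. F p * prob (cylinder t p))"
proof -
  have "expectation (\<lambda>\<omega>. F (path \<omega>))
      = expectation (\<lambda>\<omega>. \<Sum>p\<in>paths t. F p * indicator (cylinder t p) \<omega>)"
    by (rule Bochner_Integration.integral_cong) (simp_all add: adapted_eq_sum[OF assms])
  also have "\<dots> = (\<Sum>p\<in>paths t. expectation (\<lambda>\<omega>. F p * indicator (cylinder t p) \<omega>))"
    using cylinder_sets by (intro Bochner_Integration.integral_sum integrable_mult_right integrable_real_indicator)
      (auto simp: less_top[symmetric])
  also have "\<dots> = (\<Sum>p\<in>paths t. F p * prob (cylinder t p))"
    using sets.Int_space_eq2[OF cylinder_sets] by simp
  finally show ?thesis .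
qed

lemma prob_cylinder_Suc:
  assumes "y \<in> {1..n}"
  shows "prob (cylinder (Suc t) (p(Suc t := y)))
    = prob (cylinder t p) * (if y = p t then 0 else 1 / (real n - 1))"
proof -
  have "cylinder (Suc t) (p(Suc t := y)) = {\<omega> \<in> space M. (\<forall>i\<le>t. X i \<omega> = p i) \<and> X (Suc t) \<omega> = y}"
    unfolding cylinder_def by (auto simp: le_Suc_eq)
  then show ?thesis
    using step_uniform[OF assms, of t p] by (simp add: cylinder_def)
qed

text \<open>The Markov property in integrated form. Both sides are finite sums over histories, and a
  history up to \<open>Suc t\<close> splits into its last vertex and a history up to
  \<open>t\<close>; this takes the place of conditional expectations.\<close>

lemma expectation_step:
  fixes F :: "(nat \<Rightarrow> nat) \<Rightarrow> real"
  assumes F: "adapted (Suc t) F"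
  shows "expectation (\<lambda>\<omega>. F (path \<omega>))
    = expectation (\<lambda>\<omega>. (\<Sum>y\<in>{1..n} - {X t \<omega>}. F ((path \<omega>)(Suc t := y))) / (real n - 1))"
proof -
  define G where "G = (\<lambda>x. (\<Sum>y\<in>{1..n} - {x t}. F (x(Suc t := y))) / (real n - 1))"
  have G: "adapted t G"
  proof (rule adaptedI)
    fix x y :: "nat \<Rightarrow> nat" assume xy: "\<And>i. i \<le> t \<Longrightarrow> x i = y i"
    have "F (x(Suc t := v)) = F (y(Suc t := v))" for v
      by (rule adaptedD[OF F]) (auto simp: xy le_Suc_eq)
    then show "G x = G y" by (simp add: G_def xy)
  qed
  have "expectation (\<lambda>\<omega>. F (path \<omega>)) = (\<Sum>p\<in>paths (Suc t). F p * prob (cylinder (Suc t) p))"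
    by (rule expectation_adapted[OF F])
  also have "paths (Suc t) = (\<lambda>(y, g). g(Suc t := y)) ` ({1..n} \<times> paths t)"
    unfolding paths_def atMost_Suc by (rule PiE_insert_eq)
  also have "(\<Sum>p\<in>\<dots>. F p * prob (cylinder (Suc t) p))
      = (\<Sum>(y, p)\<in>{1..n} \<times> paths t. F (p(Suc t := y)) * prob (cylinder (Suc t) (p(Suc t := y))))"
  proof (subst sum.reindex)
    show "inj_on (\<lambda>(y, g). g(Suc t := y)) ({1..n} \<times> paths t)"
      unfolding paths_def by (rule inj_combinator) auto
  qed (simp add: case_prod_unfold)
  also have "\<dots> = (\<Sum>p\<in>paths t. \<Sum>y\<in>{1..n}. F (p(Suc t := y)) * prob (cylinder (Suc t) (p(Suc t := y))))"
    by (subst sum.cartesian_product[symmetric]) (rule sum.swap)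
  also have "\<dots> = (\<Sum>p\<in>paths t. G p * prob (cylinder t p))"
  proof (rule sum.cong)
    fix p assume "p \<in> paths t"
    have "(\<Sum>y\<in>{1..n}. F (p(Suc t := y)) * prob (cylinder (Suc t) (p(Suc t := y))))
        = (\<Sum>y\<in>{1..n}. if y \<noteq> p t then F (p(Suc t := y)) * prob (cylinder t p) / (real n - 1) else 0)"
      by (intro sum.cong refl) (subst prob_cylinder_Suc, auto)
    also have "\<dots> = (\<Sum>y\<in>{1..n} - {p t}. F (p(Suc t := y)) * prob (cylinder t p) / (real n - 1))"
      by (intro sum.mono_neutral_cong_right) auto
    also have "\<dots> = G p * prob (cylinder t p)"
      by (simp add: G_def sum_distrib_right sum_divide_distrib)
    finally show "(\<Sum>y\<in>{1..n}. F (p(Suc t := y)) * prob (cylinder (Suc t) (p(Suc t := y))))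
        = G p * prob (cylinder t p)" .
  qed simp
  also have "\<dots> = expectation (\<lambda>\<omega>. G (path \<omega>))"
    by (rule expectation_adapted[OF G, symmetric])
  finally show ?thesis by (simp add: G_def)
qed

lemma expectation_start:
  "expectation (\<lambda>\<omega>. f (X 0 \<omega>)) = (\<Sum>v\<in>{1..n}. f v) / real n" for f :: "nat \<Rightarrow> real"
proof -
  have a: "adapted 0 (\<lambda>x. f (x 0))" by (rule adaptedI) auto
  have "expectation (\<lambda>\<omega>. f (X 0 \<omega>)) = (\<Sum>p\<in>paths 0. f (p 0) * prob (cylinder 0 p))"
    using expectation_adapted[OF a] by simp
  also have "\<dots> = (\<Sum>p\<in>paths 0. f (p 0) / real n)"
  proof (rule sum.cong)
    fix p assume "p \<in> paths 0"
    then have "p 0 \<in> {1..n}" unfolding paths_def by (rule PiE_mem) simp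
    from start_uniform[OF this] show "f (p 0) * prob (cylinder 0 p) = f (p 0) / real n"
      by (simp add: cylinder_def)
  qed simp
  also have "\<dots> = (\<Sum>v\<in>{1..n}. f v / real n)"
  proof (rule sum.reindex_bij_witness[of _ "\<lambda>v. restrict (\<lambda>_. v) {..0}" "\<lambda>p. p 0"])
    show "restrict (\<lambda>_. p 0) {..0} = p" if "p \<in> paths 0" for p
      using that by (intro ext) (auto simp: paths_def PiE_def extensional_def)
    show "p 0 \<in> {1..n}" if "p \<in> paths 0" for p
      using that unfolding paths_def by (rule PiE_mem) simp
    show "restrict (\<lambda>_. v) {..0} \<in> paths 0" if "v \<in> {1..n}" for v
      using that unfolding paths_def by (intro restrict_PiE_iff[THEN iffD2] ballI)
  qed auto
  finally show ?thesis by (simp add: sum_divide_distrib)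
qed

text \<open>The one-step sums are not normalised, so \<open>L\<close> competes with the number n - 1
  of possible next vertices. For \<open>L\<close> > 0 the process \<open>V t\<close> times ((n - 1)
  / L)^t is a nonnegative supermartingale.\<close>

definition contracting :: "real \<Rightarrow> (nat \<Rightarrow> (nat \<Rightarrow> nat) \<Rightarrow> real) \<Rightarrow> bool" where
  "contracting L V \<longleftrightarrow> 0 \<le> L \<and> (\<forall>t. adapted t (V t)) \<and> (\<forall>t x. 0 \<le> V t x) \<and>
     (\<forall>t x. (\<forall>i. x i \<in> {1..n}) \<longrightarrow>
       (\<Sum>y\<in>{1..n} - {x t}. V (Suc t) (x(Suc t := y))) \<le> L * V t x)"

text \<open>The factor \<open>F\<close>, known at time \<open>t\<close>, lets one statement serve
  both the plain mean (\<open>F\<close> = 1) and the process stopped at a level (\<open>F\<close>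
  the indicator of not having been stopped).\<close>

lemma contracting_step:
  assumes V: "contracting L V" and F: "adapted t F" "\<And>x. 0 \<le> F x"
  shows "expectation (\<lambda>\<omega>. F (path \<omega>) * V (Suc t) (path \<omega>))
    \<le> L / (real n - 1) * expectation (\<lambda>\<omega>. F (path \<omega>) * V t (path \<omega>))"
proof -
  have aV: "adapted t (V t)" for t using V by (auto simp: contracting_def)
  have contr: "(\<Sum>y\<in>{1..n} - {x t}. V (Suc t) (x(Suc t := y))) \<le> L * V t x"
    if "\<forall>i. x i \<in> {1..n}" for t x
    using V that unfolding contracting_def by blast
  have a: "adapted (Suc t) (\<lambda>x. F x * V (Suc t) x)"
    by (rule adapted_comp2[OF adapted_mono[OF F(1)] aV]) simp
  have a': "adapted t (\<lambda>x. F x * V t x)"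
    by (rule adapted_comp2[OF F(1) aV])
  have F': "F ((path \<omega>)(Suc t := y)) = F (path \<omega>)" for \<omega> y
    by (rule adaptedD[OF F(1)]) auto
  have "expectation (\<lambda>\<omega>. F (path \<omega>) * V (Suc t) (path \<omega>))
    = expectation (\<lambda>\<omega>. (\<Sum>y\<in>{1..n} - {X t \<omega>}. F ((path \<omega>)(Suc t := y))
        * V (Suc t) ((path \<omega>)(Suc t := y))) / (real n - 1))"
    by (rule expectation_step[OF a])
  also have "\<dots> \<le> expectation (\<lambda>\<omega>. L / (real n - 1) * (F (path \<omega>) * V t (path \<omega>)))"
  proof (rule integral_mono_AE')
    show "integrable M (\<lambda>\<omega>. L / (real n - 1) * (F (path \<omega>) * V t (path \<omega>)))"
      by (intro integrable_mult_right integrable_adapted[OF a'])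
    show "AE \<omega> in M. (\<Sum>y\<in>{1..n} - {X t \<omega>}. F ((path \<omega>)(Suc t := y))
        * V (Suc t) ((path \<omega>)(Suc t := y))) / (real n - 1) \<le> L / (real n - 1) * (F (path \<omega>) * V t (path \<omega>))"
    proof (rule AE_I2)
      fix \<omega> assume "\<omega> \<in> space M"
      then have "(\<Sum>y\<in>{1..n} - {X t \<omega>}. V (Suc t) ((path \<omega>)(Suc t := y))) \<le> L * V t (path \<omega>)"
        using contr[of "path \<omega>" t] X_range by blast
      then have "F (path \<omega>) * (\<Sum>y\<in>{1..n} - {X t \<omega>}. V (Suc t) ((path \<omega>)(Suc t := y)))
          \<le> F (path \<omega>) * (L * V t (path \<omega>))"
        by (rule mult_left_mono) (rule F(2))
      then show "(\<Sum>y\<in>{1..n} - {X t \<omega>}. F ((path \<omega>)(Suc t := y))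
        * V (Suc t) ((path \<omega>)(Suc t := y))) / (real n - 1) \<le> L / (real n - 1) * (F (path \<omega>) * V t (path \<omega>))"
        using two_le_n by (simp add: F' sum_distrib_left divide_right_mono algebra_simps)
    qed
    show "AE \<omega> in M. 0 \<le> L / (real n - 1) * (F (path \<omega>) * V t (path \<omega>))"
      using V F(2) two_le_n by (intro AE_I2) (auto simp: contracting_def)
  qed
  finally show ?thesis by simp
qed

lemma contracting_expectation:
  assumes V: "contracting L V"
  shows "expectation (\<lambda>\<omega>. V t (path \<omega>))
    \<le> (L / (real n - 1)) ^ t * expectation (\<lambda>\<omega>. V 0 (path \<omega>))"
proof (induction t)
  case (Suc t)
  have "expectation (\<lambda>\<omega>. V (Suc t) (path \<omega>)) \<le> L / (real n - 1) * expectation (\<lambda>\<omega>. V t (path \<omega>))"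
    using contracting_step[OF V, of t "\<lambda>_. 1"] by (simp add: adapted_def)
  also have "\<dots> \<le> L / (real n - 1) * ((L / (real n - 1)) ^ t * expectation (\<lambda>\<omega>. V 0 (path \<omega>)))"
    using V two_le_n by (intro mult_left_mono Suc) (auto simp: contracting_def)
  finally show ?case by (simp add: mult.assoc)
qed simp

text \<open>A maximal inequality of Ville type started at time \<open>u\<close>. Up to
  \<open>u\<close> the geometric decay of the mean is used; after \<open>u\<close> only
  \<open>L\<close> <= n - 1, that is, that the mean of the stopped process cannot grow.\<close>

lemma contracting_maximal:
  assumes V: "contracting L V" and L: "L \<le> real n - 1" and c: "0 < c"
  shows "prob {\<omega> \<in> space M. \<exists>t\<ge>u. c \<le> V t (path \<omega>)}
    \<le> (L / (real n - 1)) ^ u * expectation (\<lambda>\<omega>. V 0 (path \<omega>)) / c"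
proof -
  have aV: "adapted t (V t)" for t using V by (auto simp: contracting_def)
  have V0: "0 \<le> V t x" for t x using V by (auto simp: contracting_def)
  have n1: "real n - 1 > 0" using two_le_n by simp
  \<comment> \<open>The level was reached strictly before \<open>t\<close>. Because of this shift
    \<open>H (Suc t)\<close> is still determined by the history up to \<open>t\<close>, as
    \<open>contracting_step\<close> requires of its factor.\<close>
  define H where "H = (\<lambda>t x. \<exists>i\<ge>u. i < t \<and> c \<le> V i x)"
  have aH: "adapted t (H t)" for t
    unfolding H_def by (rule adaptedI) (metis adaptedD[OF adapted_mono[OF aV]] order_less_imp_le)
  have aHS: "adapted t (H (Suc t))" for t
    unfolding H_def by (rule adaptedI) (metis adaptedD[OF adapted_mono[OF aV]] less_Suc_eq_le)
  \<comment> \<open>\<open>Q\<close> is the mean of the process frozen at \<open>c\<close> once it has reached the level \<open>c\<close>; it decreases from \<open>u\<close> on.\<close>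
  define Q where "Q = (\<lambda>t. expectation (\<lambda>\<omega>. of_bool (\<not> H t (path \<omega>)) * V t (path \<omega>) + c * of_bool (H t (path \<omega>))))"
  have Qu: "Q u = expectation (\<lambda>\<omega>. V u (path \<omega>))"
    unfolding Q_def H_def by (intro Bochner_Integration.integral_cong) auto
  have Qstep: "Q (Suc t) \<le> Q t" if "u \<le> t" for t
  proof -
    have i1: "integrable M (\<lambda>\<omega>. of_bool (\<not> H (Suc t) (path \<omega>)) * V (Suc t) (path \<omega>))"
      by (rule integrable_adapted[of "Suc t"], rule adapted_comp2[OF adapted_comp[OF aH] aV])
    have i2: "integrable M (\<lambda>\<omega>. c * of_bool (H (Suc t) (path \<omega>)))"
      by (rule integrable_adapted[of "Suc t"], rule adapted_comp[OF aH])
    have i3: "integrable M (\<lambda>\<omega>. of_bool (\<not> H (Suc t) (path \<omega>)) * V t (path \<omega>))"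
      by (rule integrable_adapted[of "t"], rule adapted_comp2[OF adapted_comp[OF aHS] aV])
    have i4: "integrable M (\<lambda>\<omega>. of_bool (\<not> H t (path \<omega>)) * V t (path \<omega>) + c * of_bool (H t (path \<omega>)))"
      by (rule integrable_adapted[of "t"], rule adapted_comp2[OF adapted_comp2[OF adapted_comp[OF aH] aV] adapted_comp[OF aH]])
    have "expectation (\<lambda>\<omega>. of_bool (\<not> H (Suc t) (path \<omega>)) * V (Suc t) (path \<omega>))
      \<le> L / (real n - 1) * expectation (\<lambda>\<omega>. of_bool (\<not> H (Suc t) (path \<omega>)) * V t (path \<omega>))"
      by (rule contracting_step[OF V]) (rule adapted_comp[OF aHS], simp)
    also have "\<dots> \<le> 1 * expectation (\<lambda>\<omega>. of_bool (\<not> H (Suc t) (path \<omega>)) * V t (path \<omega>))"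
      using L n1 V0 by (intro mult_right_mono Bochner_Integration.integral_nonneg) auto
    finally have 1: "expectation (\<lambda>\<omega>. of_bool (\<not> H (Suc t) (path \<omega>)) * V (Suc t) (path \<omega>))
      \<le> expectation (\<lambda>\<omega>. of_bool (\<not> H (Suc t) (path \<omega>)) * V t (path \<omega>))" by simp
    have "Q (Suc t) = expectation (\<lambda>\<omega>. of_bool (\<not> H (Suc t) (path \<omega>)) * V (Suc t) (path \<omega>))
        + expectation (\<lambda>\<omega>. c * of_bool (H (Suc t) (path \<omega>)))"
      unfolding Q_def by (rule Bochner_Integration.integral_add[OF i1 i2])
    also have "\<dots> \<le> expectation (\<lambda>\<omega>. of_bool (\<not> H (Suc t) (path \<omega>)) * V t (path \<omega>))
        + expectation (\<lambda>\<omega>. c * of_bool (H (Suc t) (path \<omega>)))"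
      using 1 by simp
    also have "\<dots> = expectation (\<lambda>\<omega>. of_bool (\<not> H (Suc t) (path \<omega>)) * V t (path \<omega>)
        + c * of_bool (H (Suc t) (path \<omega>)))"
      by (rule Bochner_Integration.integral_add[OF i3 i2, symmetric])
    \<comment> \<open>Pointwise the two integrands differ only if the level is first reached at time
      \<open>t\<close>; then the value \<open>V t\<close> >= \<open>c\<close> is lowered to
      \<open>c\<close>.\<close>
    also have "\<dots> \<le> Q t"
      unfolding Q_def
    proof (rule integral_mono[OF _ i4])
      show "integrable M (\<lambda>\<omega>. of_bool (\<not> H (Suc t) (path \<omega>)) * V t (path \<omega>)
        + c * of_bool (H (Suc t) (path \<omega>)))"
        by (rule Bochner_Integration.integrable_add[OF i3 i2])
      show "of_bool (\<not> H (Suc t) (path \<omega>)) * V t (path \<omega>) + c * of_bool (H (Suc t) (path \<omega>))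
        \<le> of_bool (\<not> H t (path \<omega>)) * V t (path \<omega>) + c * of_bool (H t (path \<omega>))" for \<omega>
        using that V0[of t "path \<omega>"] by (auto simp: H_def less_Suc_eq)
    qed
    finally show ?thesis .
  qed
  have Qle: "Q t \<le> Q u" if "u \<le> t" for t
    using that by (induction t rule: dec_induct) (auto intro: order_trans[OF Qstep])
  have HM: "{\<omega> \<in> space M. H t (path \<omega>)} \<in> sets M" for t by (rule adapted_sets[OF aH])
  have PH: "c * prob {\<omega> \<in> space M. H t (path \<omega>)} \<le> Q t" for t
  proof -
      have "c * prob {\<omega> \<in> space M. H t (path \<omega>)} = expectation (\<lambda>\<omega>. c * indicator {\<omega> \<in> space M. H t (path \<omega>)} \<omega>)"
        using HM[of t] by (simp add: sets.Int_space_eq2)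
      also have "\<dots> = expectation (\<lambda>\<omega>. c * of_bool (H t (path \<omega>)))"
        by (intro Bochner_Integration.integral_cong) (auto simp: indicator_def)
      also have "\<dots> \<le> Q t"
        unfolding Q_def
      proof (rule integral_mono)
        show "integrable M (\<lambda>\<omega>. c * of_bool (H t (path \<omega>)))"
          by (rule integrable_adapted[of t], rule adapted_comp[OF aH])
        show "integrable M (\<lambda>\<omega>. of_bool (\<not> H t (path \<omega>)) * V t (path \<omega>) + c * of_bool (H t (path \<omega>)))"
          by (rule integrable_adapted[of "t"], rule adapted_comp2[OF adapted_comp2[OF adapted_comp[OF aH] aV] adapted_comp[OF aH]])
      qed (use V0 in auto)
      finally show ?thesis .
    qed
  have Pt: "prob {\<omega> \<in> space M. H t (path \<omega>)} \<le> Q u / c" if "u \<le> t" for t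
    using PH[of t] Qle[OF that] c by (simp add: field_simps)
  \<comment> \<open>\<open>H t\<close> increases with \<open>t\<close>, so continuity from below
    passes from finite horizons to all times after \<open>u\<close>.\<close>
  have "(\<lambda>t. prob {\<omega> \<in> space M. H t (path \<omega>)}) \<longlonglongrightarrow> prob (\<Union>t. {\<omega> \<in> space M. H t (path \<omega>)})"
  proof (rule finite_Lim_measure_incseq)
    show "range (\<lambda>t. {\<omega> \<in> space M. H t (path \<omega>)}) \<subseteq> sets M" using HM by blast
    have "H t x" if "H s x" "s \<le> t" for s t x using that unfolding H_def by (meson order_less_le_trans)
    then show "incseq (\<lambda>t. {\<omega> \<in> space M. H t (path \<omega>)})" unfolding incseq_def by blast
  qed
  then have "prob (\<Union>t. {\<omega> \<in> space M. H t (path \<omega>)}) \<le> Q u / c"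
    by (rule Lim_bounded[where M = u]) (use Pt in blast)
  also have "(\<Union>t. {\<omega> \<in> space M. H t (path \<omega>)}) = {\<omega> \<in> space M. \<exists>t\<ge>u. c \<le> V t (path \<omega>)}"
    unfolding H_def by auto
  also have "Q u / c \<le> (L / (real n - 1)) ^ u * expectation (\<lambda>\<omega>. V 0 (path \<omega>)) / c"
    unfolding Qu using contracting_expectation[OF V, of u] c by (intro divide_right_mono) auto
  finally show ?thesis .
qed

end

section \<open>Hitting times and vertex cuts\<close>

text \<open>An extended natural is determined by its comparisons with finite times, so this
  equivalence replaces most computations with the infimum and covers the case that \<open>P\<close>
  never holds.\<close>

lemma first_time_le: "first_time P \<le> enat t \<longleftrightarrow> (\<exists>s\<le>t. P s)"
proof
  assume *: "first_time P \<le> enat t"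
  show "\<exists>s\<le>t. P s"
  proof (rule ccontr)
    assume "\<not> ?thesis"
    then have "enat (Suc t) \<le> first_time P"
      unfolding first_time_def by (auto intro!: INF_greatest simp: not_less_eq_eq[symmetric])
    with * show False by (metis Suc_n_not_le_n enat_ord_simps(1) order_trans)
  qed
next
  assume "\<exists>s\<le>t. P s"
  then obtain s where s: "s \<le> t" "P s" by blast
  then have "first_time P \<le> enat s" unfolding first_time_def by (auto intro: INF_lower)
  with s show "first_time P \<le> enat t" by (simp add: order_trans)
qed

lemma first_time_mono: "(\<And>t. Q t \<Longrightarrow> P t) \<Longrightarrow> first_time P \<le> first_time Q"
  unfolding first_time_def by (rule INF_superset_mono) auto

lemma enat_eqI: "(\<And>t. a \<le> enat t \<longleftrightarrow> b \<le> enat t) \<Longrightarrow> a = b" for a b :: enat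
  by (metis enat.exhaust enat_ord_code(3) order.refl order_antisym)

lemma enat_eq_iff: "a = b \<longleftrightarrow> (\<forall>t. a \<le> enat t \<longleftrightarrow> b \<le> enat t)" for a b :: enat
  using enat_eqI by blast

section \<open>Degrees of the trace in terms of visits\<close>

lemma finite_simple_edges: "finite (simple_edges G)"
  by (simp add: simple_edges_def)

lemma mem_trace: "e \<in># trace x t \<longleftrightarrow> (\<exists>i<t. e = {x i, x (Suc i)})"
  unfolding trace_def by auto

lemma simple_edges_trace:
  "simple_edges (trace x t) = {e. card e = 2 \<and> (\<exists>i<t. e = {x i, x (Suc i)})}"
  unfolding simple_edges_def mem_trace by auto

lemma edge_trace_iff:
  assumes "u \<noteq> v"
  shows "{u, v} \<in> simple_edges (trace x t) \<longleftrightarrow> (\<exists>i<t. {x i, x (Suc i)} = {u, v})"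
  using assms unfolding simple_edges_trace by auto

text \<open>Every edge at \<open>v\<close> arises from a departure or from an arrival. The two
  counts are kept apart because a departure before \<open>t\<close> is a visit at a time before
  \<open>t\<close>, while an arrival may happen at time \<open>t\<close> itself.\<close>

lemma simple_degree_le:
  "simple_degree (trace x t) v \<le> card {i. i < t \<and> x i = v} + card {i. i < t \<and> x (Suc i) = v}"
proof -
  have "{e \<in> simple_edges (trace x t). v \<in> e}
      \<subseteq> (\<lambda>i. {x i, x (Suc i)}) ` ({i. i < t \<and> x i = v} \<union> {i. i < t \<and> x (Suc i) = v})"
    unfolding simple_edges_trace by auto
  then have "simple_degree (trace x t) v \<le> card ({i. i < t \<and> x i = v} \<union> {i. i < t \<and> x (Suc i) = v})"
    unfolding simple_degree_def by (rule surj_card_le[rotated]) auto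
  also have "\<dots> \<le> card {i. i < t \<and> x i = v} + card {i. i < t \<and> x (Suc i) = v}"
    by (rule card_Un_le)
  finally show ?thesis .
qed

lemma card_arrivals_le: "card {i. i < t \<and> x (Suc i) = v} \<le> visits x t v"
proof -
  have "card {i. i < t \<and> x (Suc i) = v} = card (Suc ` {i. i < t \<and> x (Suc i) = v})"
    by (rule card_image[symmetric]) auto
  also have "\<dots> \<le> visits x t v"
    unfolding visits_def by (intro card_mono) auto
  finally show ?thesis .
qed

lemma finite_visits: "finite {i. i \<le> t \<and> x i = v}" for t :: nat
  by (rule finite_subset[of _ "{..t}"]) auto

lemma card_departures_le: "card {i. i < t \<and> x i = v} \<le> visits x t v"
  unfolding visits_def by (intro card_mono finite_visits) auto

lemma visits_Suc: "visits x (Suc t) v = visits x t v + of_bool (x (Suc t) = v)"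
proof -
  have "{i. i \<le> Suc t \<and> x i = v} = {i. i \<le> t \<and> x i = v} \<union> (if x (Suc t) = v then {Suc t} else {})"
    by (auto simp: le_Suc_eq)
  then show ?thesis
    unfolding visits_def by (auto simp: card_insert_if finite_visits)
qed

lemma min_simple_degree_ge_iff:
  assumes "1 \<le> n"
  shows "m \<le> min_simple_degree n G \<longleftrightarrow> (\<forall>v\<in>{1..n}. m \<le> simple_degree G v)"
  using assms unfolding min_simple_degree_def by (subst Min_ge_iff) auto

text \<open>A visit provides at most one arrival edge and one departure edge, so degree 2k - 1 is at
  most twice the number of visits, and parity rounds this up to k visits.\<close>

lemma tau_C_le_tau_delta:
  assumes "1 \<le> n" "1 \<le> k"
  shows "tau_C n k x \<le> tau_delta n (2 * k - 1) x"
  unfolding tau_C_def tau_delta_def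
proof (rule first_time_mono, intro ballI)
  fix t v assume *: "spanning n (trace x t) \<and> 2 * k - 1 \<le> min_simple_degree n (trace x t)"
    and v: "v \<in> {1..n}"
  then have "2 * k - 1 \<le> simple_degree (trace x t) v"
    by (simp add: min_simple_degree_ge_iff assms)
  also have "\<dots> \<le> 2 * visits x t v"
    using simple_degree_le[of x t v] card_arrivals_le[of t x v] card_departures_le[of t x v] by linarith
  finally show "k \<le> visits x t v" using assms by linarith
qed

text \<open>The additional step is due to the current vertex, which has not been left yet. At time
  \<open>Suc s\<close> departures are visits up to \<open>s\<close>, and arrivals exceed visits up
  to \<open>s\<close> by at most one. From 2k <= 2 * visits + 1, parity gives k visits already at
  time \<open>s\<close>.\<close>

lemma tau_C_Suc_le_tau_delta:
  assumes "1 \<le> n" "1 \<le> k"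
  shows "tau_C n k x + 1 \<le> tau_delta n (2 * k) x"
proof -
  have "\<exists>s. t = Suc s \<and> (\<forall>v\<in>{1..n}. k \<le> visits x s v)"
    if *: "2 * k \<le> min_simple_degree n (trace x t)" for t
  proof (cases t)
    case 0
    have "simple_degree (trace x 0) 1 \<le> 0" using simple_degree_le[of x 0 1] by simp
    then show ?thesis using * assms 0 by (force simp: min_simple_degree_ge_iff)
  next
    case (Suc s)
    have "k \<le> visits x s v" if "v \<in> {1..n}" for v
    proof -
      have "2 * k \<le> simple_degree (trace x t) v"
        using * that by (simp add: min_simple_degree_ge_iff assms)
      also have "\<dots> \<le> visits x s v + visits x t v"
        using simple_degree_le[of x t v] card_arrivals_le[of t x v]
        by (simp add: Suc visits_def less_Suc_eq_le)
      also have "\<dots> \<le> 2 * visits x s v + 1"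
        by (simp add: Suc visits_Suc)
      finally show ?thesis by linarith
    qed
    with Suc show ?thesis by blast
  qed
  note * = this
  show ?thesis
    unfolding tau_delta_def first_time_def[of "\<lambda>t. spanning n (trace x t) \<and> _ t"]
  proof (rule INF_greatest)
    fix t assume "t \<in> {t. spanning n (trace x t) \<and> 2 * k \<le> min_simple_degree n (trace x t)}"
    with * obtain s where s: "t = Suc s" "\<forall>v\<in>{1..n}. k \<le> visits x s v" by blast
    then have "tau_C n k x \<le> enat s" unfolding tau_C_def first_time_le by blast
    then have "tau_C n k x + 1 \<le> enat s + 1" by (rule add_right_mono)
    then show "tau_C n k x + 1 \<le> enat t" by (simp add: s one_enat_def)
  qed
qed

section \<open>Connectivity, degrees and cuts\<close>

lemma vertex_connected_degree:
  assumes vc: "vertex_connected n m G" and v: "v \<in> {1..n}"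
  shows "m \<le> simple_degree G v"
proof (rule ccontr)
  assume "\<not> ?thesis"
  then have d: "simple_degree G v < m" by simp
  \<comment> \<open>The neighbourhood of \<open>v\<close> is a cut with fewer than \<open>m\<close>
    vertices; since m < n, some vertex other than \<open>v\<close> remains to be cut off from
    it.\<close>
  define S where "S = {u \<in> {1..n}. u \<noteq> v \<and> {u, v} \<in> simple_edges G}"
  have "card S = card ((\<lambda>u. {u, v}) ` S)"
    by (rule card_image[symmetric]) (auto simp: S_def inj_on_def doubleton_eq_iff)
  also have "\<dots> \<le> simple_degree G v"
    unfolding simple_degree_def
    by (intro card_mono) (auto simp: S_def finite_simple_edges)
  finally have S: "card S < m" using d by simp
  have fS: "finite S" "S \<subseteq> {1..n}" by (auto simp: S_def)
  have con: "induces_connected ({1..n} - S) (simple_edges G)" and mn: "m < n"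
    using vc S fS unfolding vertex_connected_def by auto
  have "card (insert v S) < card {1..n}"
    using S mn fS by (simp add: card_insert_if)
  then have "\<not> {1..n} \<subseteq> insert v S"
    using card_mono[of "insert v S" "{1..n}"] fS by force
  then obtain u where u: "u \<in> {1..n} - S" "u \<noteq> v" by blast
  have vS: "v \<in> {1..n} - S" using v by (simp add: S_def)
  have "(v, u) \<in> {(x, y). x \<in> {1..n} - S \<and> y \<in> {1..n} - S \<and> {x, y} \<in> simple_edges G}\<^sup>*"
    using con u vS unfolding induces_connected_def by blast
  then obtain w where w: "w \<in> {1..n} - S" "{v, w} \<in> simple_edges G"
    using u(2) by (cases rule: converse_rtranclE) auto
  have "w \<noteq> v" using w(2) by (auto simp: simple_edges_def)
  with w show False by (auto simp: S_def insert_commute)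
qed

lemma vertex_connected_spanning:
  assumes vc: "vertex_connected n m G" and m: "1 \<le> m"
  shows "spanning n G"
  unfolding spanning_def
proof
  fix v assume "v \<in> {1..n}"
  from vertex_connected_degree[OF vc this] m have "{e \<in> simple_edges G. v \<in> e} \<noteq> {}"
    unfolding simple_degree_def by (metis card.empty not_one_le_zero order_trans)
  then show "v \<in> \<Union> (set_mset G)" by (auto simp: simple_edges_def)
qed

lemma tau_delta_le_tau_kappa:
  assumes "1 \<le> n"
  shows "tau_delta n m x \<le> tau_kappa n m x"
  unfolding tau_delta_def tau_kappa_def
  using vertex_connected_degree assms by (intro first_time_mono) (auto simp: min_simple_degree_ge_iff)

text \<open>Phrased by the steps of the walk and not by the edge set of the trace, so that it can be
  updated one step at a time. Steps to and from \<open>S\<close> and steps within each part are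
  free.\<close>

definition separated :: "nat set \<Rightarrow> nat set \<Rightarrow> (nat \<Rightarrow> nat) \<Rightarrow> nat \<Rightarrow> bool" where
  "separated A S x t \<longleftrightarrow> (\<forall>i<t. \<not> (x i \<in> A \<and> x (Suc i) \<notin> A \<union> S) \<and> \<not> (x i \<notin> A \<union> S \<and> x (Suc i) \<in> A))"

text \<open>After deletion of \<open>S\<close>, take the set reachable from one of two unconnected
  vertices and its complement. \<open>A\<close> is the smaller of the two, whence 2|A| + |S| <=
  n.\<close>

lemma not_connected_separated:
  assumes "\<not> vertex_connected n m (trace x t)" "m < n" "\<And>i. x i \<in> {1..n}"
  obtains A S where "A \<subseteq> {1..n}" "S \<subseteq> {1..n}" "A \<inter> S = {}" "A \<noteq> {}" "2 * card A + card S \<le> n"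
    "card S < m" "separated A S x t"
proof -
  obtain S where S: "S \<subseteq> {1..n}" "card S < m"
    and nc: "\<not> induces_connected ({1..n} - S) (simple_edges (trace x t))"
    using assms(1,2) unfolding vertex_connected_def by auto
  define V where "V = {1..n} - S"
  define R where "R = {(a, b). a \<in> V \<and> b \<in> V \<and> {a, b} \<in> simple_edges (trace x t)}"
  have fS: "finite S" using S finite_subset by blast
  have cV: "card V + card S = n"
    unfolding V_def using S fS card_mono[OF _ S(1)] by (simp add: card_Diff_subset)
  have "V \<noteq> {}" using cV S assms(2) by auto
  then obtain u v where uv: "u \<in> V" "v \<in> V" "(u, v) \<notin> R\<^sup>*"
    using nc unfolding induces_connected_def V_def[symmetric] R_def[symmetric] by blast
  define C where "C = {w \<in> V. (u, w) \<in> R\<^sup>*}"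
  have cl: "b \<in> C" if "a \<in> C" "b \<in> V" "{a, b} \<in> simple_edges (trace x t)" for a b
    using that unfolding C_def R_def by (auto intro: rtrancl_into_rtrancl)
  have CV: "C \<subseteq> V" "u \<in> C" "v \<in> V - C" using uv by (auto simp: C_def)
  have fV: "finite V" by (simp add: V_def)
  have fC: "finite C" using CV(1) fV finite_subset by blast
  have sep: "separated A S x t" if "A \<subseteq> V"
    and A: "\<And>a b. a \<in> A \<Longrightarrow> b \<in> V - A \<Longrightarrow> {a, b} \<notin> simple_edges (trace x t)" for A
    unfolding separated_def
  proof (intro allI impI conjI notI)
    fix i assume i: "i < t"
    { assume *: "x i \<in> A \<and> x (Suc i) \<notin> A \<union> S"
      then have "x (Suc i) \<in> V - A" "x i \<noteq> x (Suc i)" using assms(3) by (auto simp: V_def)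
      then show False using A[of "x i" "x (Suc i)"] * i edge_trace_iff[of "x i" "x (Suc i)" x t] by auto }
    { assume *: "x i \<notin> A \<union> S \<and> x (Suc i) \<in> A"
      then have "x i \<in> V - A" "x (Suc i) \<noteq> x i" using assms(3) by (auto simp: V_def)
      then show False using A[of "x (Suc i)" "x i"] * i edge_trace_iff[of "x (Suc i)" "x i" x t] by auto }
  qed
  have sC: "separated C S x t" using cl CV by (intro sep) auto
  have sC': "separated (V - C) S x t"
    using cl CV by (intro sep) (auto simp: insert_commute)
  have card: "card C + card (V - C) = card V"
    using card_Diff_subset[OF fC CV(1)] card_mono[OF fV CV(1)] by simp
  show ?thesis
  proof (cases "card C \<le> card (V - C)")
    case True
    show ?thesis
      by (rule that[of C S]) (use True card cV CV S sC in \<open>auto simp: V_def\<close>)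
  next
    case False
    show ?thesis
      by (rule that[of "V - C" S]) (use False card cV CV S sC' in \<open>auto simp: V_def\<close>)
  qed
qed

text \<open>Connectivity at the two times closes the chain tau_C <= tau_delta <= tau_kappa <= tau_C
  for 2k - 1, and the same chain shifted by one step for 2k.\<close>

lemma hitting_times_coincide:
  assumes "1 \<le> k" "2 * k < n"
    and t: "tau_C n k x = enat t"
    and "vertex_connected n (2 * k - 1) (trace x t)"
    and "vertex_connected n (2 * k) (trace x (Suc t))"
  shows "tau_C n k x = tau_delta n (2 * k - 1) x \<and> tau_delta n (2 * k - 1) x = tau_kappa n (2 * k - 1) x \<and>
    tau_C n k x + 1 = tau_delta n (2 * k) x \<and> tau_delta n (2 * k) x = tau_kappa n (2 * k) x"
proof -
  have n: "1 \<le> n" using assms by simp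
  have "tau_kappa n (2 * k - 1) x \<le> tau_C n k x"
    unfolding t tau_kappa_def first_time_le using assms(1,4) vertex_connected_spanning by fastforce
  moreover have "tau_kappa n (2 * k) x \<le> tau_C n k x + 1"
  proof -
    have "tau_kappa n (2 * k) x \<le> enat (Suc t)"
      unfolding tau_kappa_def first_time_le using assms(1,5) vertex_connected_spanning by fastforce
    then show ?thesis by (simp add: t one_enat_def)
  qed
  ultimately show ?thesis
    using tau_C_le_tau_delta[OF n assms(1), of x] tau_C_Suc_le_tau_delta[OF n assms(1), of x]
      tau_delta_le_tau_kappa[OF n, of "2 * k - 1" x] tau_delta_le_tau_kappa[OF n, of "2 * k" x]
    by (meson order.antisym order.trans)
qed

section \<open>Exponential weights for separated sets\<close>

definition set_visits :: "nat set \<Rightarrow> (nat \<Rightarrow> nat) \<Rightarrow> nat \<Rightarrow> nat" where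
  "set_visits A x t = card {i. i \<le> t \<and> x i \<in> A}"

text \<open>The function h of the overview, normalised to 1 off \<open>A\<close> and
  \<open>S\<close>. The value \<open>hS\<close> will exceed 1, since every allowed entry into
  \<open>A\<close> from outside goes through \<open>S\<close>. The value \<open>hA\<close> will be
  small for singletons, which the walk can leave only towards \<open>S\<close>.\<close>

definition potential :: "nat set \<Rightarrow> nat set \<Rightarrow> real \<Rightarrow> real \<Rightarrow> nat \<Rightarrow> real" where
  "potential A S hA hS v = (if v \<in> A then hA else if v \<in> S then hS else 1)"

definition separation_weight ::
    "nat set \<Rightarrow> nat set \<Rightarrow> real \<Rightarrow> real \<Rightarrow> real \<Rightarrow> nat \<Rightarrow> (nat \<Rightarrow> nat) \<Rightarrow> real" where
  "separation_weight A S z hA hS t x =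
     of_bool (separated A S x t) * z ^ set_visits A x t * potential A S hA hS (x t)"

lemma set_visits_cong: "(\<And>i. i \<le> t \<Longrightarrow> x i = y i) \<Longrightarrow> set_visits A x t = set_visits A y t"
  unfolding set_visits_def by (metis (lifting))

lemma separated_cong: "(\<And>i. i \<le> t \<Longrightarrow> x i = y i) \<Longrightarrow> separated A S x t = separated A S y t"
  unfolding separated_def by (metis Suc_leI order_less_imp_le)

lemma set_visits_Suc_upd:
  "set_visits A (x(Suc t := y)) (Suc t) = set_visits A x t + of_bool (y \<in> A)"
proof -
  have fin: "finite {i. i \<le> t \<and> x i \<in> A}" by (rule finite_subset[of _ "{..t}"]) auto
  have "{i. i \<le> Suc t \<and> (x(Suc t := y)) i \<in> A}
      = {i. i \<le> t \<and> x i \<in> A} \<union> (if y \<in> A then {Suc t} else {})"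
    by (auto simp: le_Suc_eq)
  then show ?thesis unfolding set_visits_def using fin by (auto simp: card_insert_if)
qed

lemma separated_Suc_upd:
  "separated A S (x(Suc t := y)) (Suc t) \<longleftrightarrow>
     separated A S x t \<and> \<not> (x t \<in> A \<and> y \<notin> A \<union> S) \<and> \<not> (x t \<notin> A \<union> S \<and> y \<in> A)"
  unfolding separated_def by (auto simp: less_Suc_eq)

lemma adapted_separated: "adapted t (\<lambda>x. separated A S x t)"
  by (rule adaptedI) (rule separated_cong)

lemma adapted_set_visits: "adapted t (\<lambda>x. set_visits A x t)"
  by (rule adaptedI) (rule set_visits_cong)

lemma adapted_avoid: "adapted t (\<lambda>x. \<forall>i\<le>t. x i \<notin> A)"
  by (rule adaptedI) (metis (full_types))

lemma adapted_covered: "adapted t (\<lambda>x. \<forall>v\<in>{1..n}. \<exists>i\<le>t. x i = v)"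
  by (rule adaptedI, intro ball_cong ex_cong1 refl) auto

lemma adapted_coord: "adapted t (\<lambda>x. f (x t))"
  by (rule adaptedI) auto

lemma adapted_separation_weight: "adapted t (separation_weight A S z hA hS t)"
  unfolding separation_weight_def
  by (intro adapted_comp2[of t _ _ "(*)"] adapted_comp[OF adapted_separated]
      adapted_comp[OF adapted_set_visits] adapted_coord)

lemma sum_three:
  fixes A S :: "nat set" and \<alpha> \<beta> \<gamma> :: real
  assumes "A \<subseteq> {1..n}" "S \<subseteq> {1..n}" "A \<inter> S = {}"
  shows "(\<Sum>y\<in>{1..n}. if y \<in> A then \<alpha> else if y \<in> S then \<beta> else \<gamma>)
    = real (card A) * \<alpha> + real (card S) * \<beta> + (real n - real (card A) - real (card S)) * \<gamma>"
proof -
  have fin: "finite A" "finite S" using assms finite_subset by blast+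
  have "(\<Sum>y\<in>{1..n}. if y \<in> A then \<alpha> else if y \<in> S then \<beta> else \<gamma>)
    = (\<Sum>y\<in>{1..n}. \<gamma> + (if y \<in> A then \<alpha> - \<gamma> else 0) + (if y \<in> S then \<beta> - \<gamma> else 0))"
    using assms(3) by (intro sum.cong) auto
  also have "\<dots> = real n * \<gamma> + (\<Sum>y\<in>{1..n}. if y \<in> A then \<alpha> - \<gamma> else 0) + (\<Sum>y\<in>{1..n}. if y \<in> S then \<beta> - \<gamma> else 0)"
    by (simp add: sum.distrib)
  also have "(\<Sum>y\<in>{1..n}. if y \<in> A then \<alpha> - \<gamma> else 0) = (\<Sum>y\<in>A. \<alpha> - \<gamma>)"
    by (intro sum.mono_neutral_cong_right) (use assms in auto)
  also have "(\<Sum>y\<in>{1..n}. if y \<in> S then \<beta> - \<gamma> else 0) = (\<Sum>y\<in>S. \<beta> - \<gamma>)"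
    by (intro sum.mono_neutral_cong_right) (use assms in auto)
  finally show ?thesis by (simp add: algebra_simps)
qed

context complete_graph_walk
begin

lemma adapted_sets_Ex:
  assumes "\<And>t. adapted t (Q t)"
  shows "{\<omega> \<in> space M. \<exists>t\<ge>u. Q t (path \<omega>)} \<in> sets M"
proof -
  have "{\<omega> \<in> space M. \<exists>t\<ge>u. Q t (path \<omega>)} = (\<Union>t\<in>{u..}. {\<omega> \<in> space M. Q t (path \<omega>)})"
    by auto
  also have "\<dots> \<in> sets M"
    using adapted_sets[OF assms] by (intro sets.countable_UN') auto
  finally show ?thesis .
qed

text \<open>The three inequalities are the one-step condition for a current vertex outside
  \<open>A\<close> and \<open>S\<close>, in \<open>S\<close>, and in \<open>A\<close>. The terms - 1
  account for the current vertex, which cannot be the next one. For |A| = 1 they remove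
  \<open>z\<close> from the condition \<open>inside\<close>, which is why singletons admit a much
  larger \<open>z\<close>.\<close>

lemma contracting_separation_weight:
  fixes z hA hS L :: real
  assumes AS: "A \<subseteq> {1..n}" "S \<subseteq> {1..n}" "A \<inter> S = {}"
    and pos: "0 \<le> z" "0 \<le> hA" "0 \<le> hS" "0 \<le> L"
    and outside: "real n - 1 - card A - card S + card S * hS \<le> L"
    and via: "real n - card A - card S + (real (card S) - 1) * hS + card A * z * hA \<le> L * hS"
    and inside: "card S * hS + (real (card A) - 1) * z * hA \<le> L * hA"
  shows "contracting L (separation_weight A S z hA hS)"
  unfolding contracting_def
proof (intro conjI allI impI)
  show "0 \<le> separation_weight A S z hA hS t x" for t x
    using pos by (auto simp: separation_weight_def potential_def)
  fix t :: nat and x :: "nat \<Rightarrow> nat" assume x: "\<forall>i. x i \<in> {1..n}"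
  \<comment> \<open>The factor gained in the step to \<open>y\<close>: forbidden moves have value 0,
    and landing in \<open>A\<close> earns \<open>z\<close>.\<close>
  define g where "g = (\<lambda>y. if (x t \<in> A \<and> y \<notin> A \<union> S) \<or> (x t \<notin> A \<union> S \<and> y \<in> A) then 0
    else if y \<in> A then z * hA else if y \<in> S then hS else 1 :: real)"
  have xt: "x t \<in> {1..n}" using x by blast
  have "(\<Sum>y\<in>{1..n} - {x t}. g y) = (\<Sum>y\<in>{1..n}. g y) - g (x t)"
    using xt by (simp add: sum_diff1)
  also have "\<dots> \<le> L * potential A S hA hS (x t)"
  proof -
    consider "x t \<in> A" | "x t \<in> S" "x t \<notin> A" | "x t \<notin> A \<union> S" by blast
    then show ?thesis
    proof cases
      case 1
      then have "(\<Sum>y\<in>{1..n}. g y) = real (card A) * (z * hA) + real (card S) * hS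
          + (real n - real (card A) - real (card S)) * 0"
        unfolding sum_three[OF AS, symmetric] by (intro sum.cong) (auto simp: g_def)
      moreover have "g (x t) = z * hA" using 1 AS by (auto simp: g_def)
      ultimately show ?thesis
        using 1 inside by (simp add: potential_def algebra_simps)
    next
      case 2
      then have "(\<Sum>y\<in>{1..n}. g y) = real (card A) * (z * hA) + real (card S) * hS
          + (real n - real (card A) - real (card S)) * 1"
        unfolding sum_three[OF AS, symmetric] by (intro sum.cong) (auto simp: g_def)
      moreover have "g (x t) = hS" using 2 AS by (auto simp: g_def)
      ultimately show ?thesis
        using 2 via by (simp add: potential_def algebra_simps)
    next
      case 3
      then have "(\<Sum>y\<in>{1..n}. g y) = real (card A) * 0 + real (card S) * hS
          + (real n - real (card A) - real (card S)) * 1"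
        unfolding sum_three[OF AS, symmetric] by (intro sum.cong) (auto simp: g_def)
      moreover have "g (x t) = 1" using 3 AS by (auto simp: g_def)
      ultimately show ?thesis
        using 3 outside by (simp add: potential_def algebra_simps)
    qed
  qed
  finally have main: "(\<Sum>y\<in>{1..n} - {x t}. g y) \<le> L * potential A S hA hS (x t)" .
  have "(\<Sum>y\<in>{1..n} - {x t}. separation_weight A S z hA hS (Suc t) (x(Suc t := y)))
      = (\<Sum>y\<in>{1..n} - {x t}. of_bool (separated A S x t) * z ^ set_visits A x t * g y)"
    unfolding separation_weight_def separated_Suc_upd set_visits_Suc_upd
    by (intro sum.cong) (auto simp: g_def potential_def power_add)
  also have "\<dots> = of_bool (separated A S x t) * z ^ set_visits A x t * (\<Sum>y\<in>{1..n} - {x t}. g y)"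
    by (simp add: sum_distrib_left)
  also have "\<dots> \<le> of_bool (separated A S x t) * z ^ set_visits A x t * (L * potential A S hA hS (x t))"
    using pos by (intro mult_left_mono main) auto
  finally show "(\<Sum>y\<in>{1..n} - {x t}. separation_weight A S z hA hS (Suc t) (x(Suc t := y)))
      \<le> L * separation_weight A S z hA hS t x"
    by (simp add: separation_weight_def algebra_simps)
qed (use pos adapted_separation_weight in auto)

text \<open>On the event the weight reaches z^v * c at some time from \<open>u\<close> on, so the
  maximal inequality applies. The level \<open>c\<close> bounds the potential of the current
  position from below and so encodes whether the walk may still be in \<open>A\<close>.\<close>

lemma prob_separated_le:
  fixes z hA hS L c :: real
  assumes AS: "A \<subseteq> {1..n}" "S \<subseteq> {1..n}" "A \<inter> S = {}"
    and pos: "1 \<le> z" "0 \<le> hA" "1 \<le> hS" "0 \<le> L" "L \<le> real n - 1" "0 < c"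
    and outside: "real n - 1 - card A - card S + card S * hS \<le> L"
    and via: "real n - card A - card S + (real (card S) - 1) * hS + card A * z * hA \<le> L * hS"
    and inside: "card S * hS + (real (card A) - 1) * z * hA \<le> L * hA"
  shows "prob {\<omega> \<in> space M. \<exists>t\<ge>u. separated A S (path \<omega>) t \<and> v \<le> set_visits A (path \<omega>) t
      \<and> c \<le> potential A S hA hS (X t \<omega>)}
    \<le> (L / (real n - 1)) ^ u * (card A * z * hA / n + hS) / (z ^ v * c)"
proof -
  let ?V = "separation_weight A S z hA hS"
  have V: "contracting L ?V"
    by (rule contracting_separation_weight) (use assms in auto)
  have n: "real n > 0" "real n - 1 > 0" using two_le_n by auto
  have pot: "0 \<le> potential A S hA hS w" for w using pos by (auto simp: potential_def)
  have cS: "card A + card S \<le> n"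
    using card_mono[of "{1..n}" "A \<union> S"] AS finite_subset[OF AS(1)] finite_subset[OF AS(2)]
    by (simp add: card_Un_disjoint)
  have "{\<omega> \<in> space M. \<exists>t\<ge>u. separated A S (path \<omega>) t \<and> v \<le> set_visits A (path \<omega>) t
      \<and> c \<le> potential A S hA hS (X t \<omega>)} \<subseteq> {\<omega> \<in> space M. \<exists>t\<ge>u. z ^ v * c \<le> ?V t (path \<omega>)}"
  proof safe
    fix \<omega> t assume *: "separated A S (path \<omega>) t" "v \<le> set_visits A (path \<omega>) t"
      "c \<le> potential A S hA hS (X t \<omega>)" "u \<le> t"
    have "z ^ v * c \<le> z ^ set_visits A (path \<omega>) t * potential A S hA hS (X t \<omega>)"
      using * pos by (intro mult_mono power_increasing) auto
    then show "\<exists>t\<ge>u. z ^ v * c \<le> ?V t (path \<omega>)"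
      using * by (intro exI[of _ t]) (simp add: separation_weight_def)
  qed
  moreover have "{\<omega> \<in> space M. \<exists>t\<ge>u. z ^ v * c \<le> ?V t (path \<omega>)} \<in> sets M"
    by (rule adapted_sets_Ex[OF adapted_comp[OF adapted_separation_weight]])
  ultimately have "prob {\<omega> \<in> space M. \<exists>t\<ge>u. separated A S (path \<omega>) t \<and> v \<le> set_visits A (path \<omega>) t
      \<and> c \<le> potential A S hA hS (X t \<omega>)} \<le> prob {\<omega> \<in> space M. \<exists>t\<ge>u. z ^ v * c \<le> ?V t (path \<omega>)}"
    by (rule finite_measure_mono)
  also have "\<dots> \<le> (L / (real n - 1)) ^ u * expectation (\<lambda>\<omega>. ?V 0 (path \<omega>)) / (z ^ v * c)"
    using pos by (intro contracting_maximal[OF V]) auto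
  also have "\<dots> \<le> (L / (real n - 1)) ^ u * (card A * z * hA / n + hS) / (z ^ v * c)"
  proof (intro divide_right_mono mult_left_mono)
    have z0: "set_visits A x 0 = of_bool (x 0 \<in> A)" for x
    proof -
      have "{i. i \<le> 0 \<and> x i \<in> A} = (if x 0 \<in> A then {0} else {})" by auto
      then show ?thesis by (simp add: set_visits_def)
    qed
    have "expectation (\<lambda>\<omega>. ?V 0 (path \<omega>))
        = expectation (\<lambda>\<omega>. (\<lambda>y. if y \<in> A then z * hA else if y \<in> S then hS else 1) (X 0 \<omega>))"
      by (intro Bochner_Integration.integral_cong)
        (auto simp: separation_weight_def z0 potential_def separated_def)
    also have "\<dots> = (\<Sum>y\<in>{1..n}. if y \<in> A then z * hA else if y \<in> S then hS else 1) / n"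
      by (rule expectation_start)
    also have "\<dots> = card A * z * hA / n + (card S * hS + (real n - card A - card S)) / n"
      unfolding sum_three[OF AS] by (simp add: add_divide_distrib)
    also have "(card S * hS + (real n - card A - card S)) / n \<le> hS"
    proof -
      have "card S * hS + (real n - card A - card S) * 1 \<le> card S * hS + (real n - card A - card S) * hS"
        using pos cS by (intro add_left_mono mult_left_mono) auto
      also have "\<dots> = (real n - card A) * hS" by (simp add: algebra_simps)
      also have "\<dots> \<le> n * hS" using pos by (intro mult_right_mono) auto
      finally show ?thesis using n by (simp add: field_simps)
    qed
    finally show "expectation (\<lambda>\<omega>. ?V 0 (path \<omega>)) \<le> card A * z * hA / n + hS" by simp
  qed (use pos n in auto)
  finally show ?thesis .
qed

text \<open>Makes tau_C finite almost surely. Here the base is 1/2, so that few visits mean a large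
  weight. From \<open>v\<close> the next step cannot be a visit to \<open>v\<close>; the factor 3/2
  at \<open>v\<close> compensates for this, while 3/2 * 1/2 stays below 1. The contraction then
  holds with a loss of 1/4 in \<open>L\<close>, even for n = 2.\<close>

lemma prob_visits_bounded: "prob {\<omega> \<in> space M. \<forall>t. visits (path \<omega>) t v < k} = 0"
  if v: "v \<in> {1..n}"
proof -
  define V where "V = (\<lambda>t x. (1/2) ^ visits x t v * (if x t = v then 3/2 else 1 :: real))"
  define L where "L = real n - 1 - 1/4"
  have n: "real n - 1 \<ge> 1" using two_le_n by simp
  have vis: "visits (x(Suc t := y)) (Suc t) v = visits x t v + of_bool (y = v)" for x t y
    using set_visits_Suc_upd[of "{v}" x t y] by (simp add: set_visits_def visits_def)
  have ad: "adapted t (\<lambda>x. visits x t v)" for t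
    using adapted_set_visits[of t "{v}"] by (simp add: set_visits_def visits_def)
  have aV: "adapted t (V t)" for t
    unfolding V_def by (intro adapted_comp2[of t _ _ "(*)"] adapted_comp[OF ad] adapted_coord)
  have con: "contracting L V"
    unfolding contracting_def
  proof (intro conjI allI impI aV)
    show "0 \<le> L" using n by (simp add: L_def)
    show "0 \<le> V t x" for t x by (simp add: V_def)
    fix t :: nat and x :: "nat \<Rightarrow> nat" assume x: "\<forall>i. x i \<in> {1..n}"
    define g where "g = (\<lambda>y. if y = v then 3/4 else 1 :: real)"
    have "(\<Sum>y\<in>{1..n} - {x t}. g y) = (\<Sum>y\<in>{1..n}. g y) - g (x t)"
      using x by (simp add: sum_diff1)
    also have "(\<Sum>y\<in>{1..n}. g y) = real n - 1/4"
      using sum_three[of "{v}" n "{}" "3/4" 0 1] v by (simp add: g_def cong: if_cong)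
    also have "real n - 1/4 - g (x t) \<le> L * (if x t = v then 3/2 else 1)"
      using n by (simp add: g_def L_def algebra_simps)
    finally have main: "(\<Sum>y\<in>{1..n} - {x t}. g y) \<le> L * (if x t = v then 3/2 else 1)" .
    have "(\<Sum>y\<in>{1..n} - {x t}. V (Suc t) (x(Suc t := y)))
        = (\<Sum>y\<in>{1..n} - {x t}. (1/2) ^ visits x t v * g y)"
      unfolding V_def vis g_def by (intro sum.cong) auto
    also have "\<dots> = (1/2) ^ visits x t v * (\<Sum>y\<in>{1..n} - {x t}. g y)"
      by (simp add: sum_distrib_left)
    also have "\<dots> \<le> (1/2) ^ visits x t v * (L * (if x t = v then 3/2 else 1))"
      by (intro mult_left_mono main) auto
    finally show "(\<Sum>y\<in>{1..n} - {x t}. V (Suc t) (x(Suc t := y))) \<le> L * V t x"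
      by (simp add: V_def algebra_simps)
  qed
  define E where "E = expectation (\<lambda>\<omega>. V 0 (path \<omega>)) / (1/2) ^ k"
  have le: "prob {\<omega> \<in> space M. \<forall>t. visits (path \<omega>) t v < k} \<le> (L / (real n - 1)) ^ u * E" for u
  proof -
    have "prob {\<omega> \<in> space M. \<forall>t. visits (path \<omega>) t v < k}
        \<le> prob {\<omega> \<in> space M. \<exists>t\<ge>u. (1/2) ^ k \<le> V t (path \<omega>)}"
    proof (rule finite_measure_mono)
      show "{\<omega> \<in> space M. \<forall>t. visits (path \<omega>) t v < k}
        \<subseteq> {\<omega> \<in> space M. \<exists>t\<ge>u. (1/2) ^ k \<le> V t (path \<omega>)}"
      proof safe
        fix \<omega> assume *: "\<forall>t. visits (path \<omega>) t v < k"
        have "(1/2) ^ k * 1 \<le> V u (path \<omega>)"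
          unfolding V_def using * by (intro mult_mono power_decreasing) (auto intro: less_imp_le)
        then show "\<exists>t\<ge>u. (1/2) ^ k \<le> V t (path \<omega>)" by auto
      qed
      show "{\<omega> \<in> space M. \<exists>t\<ge>u. (1/2) ^ k \<le> V t (path \<omega>)} \<in> sets M"
        by (rule adapted_sets_Ex[OF adapted_comp[OF aV]])
    qed
    also have "\<dots> \<le> (L / (real n - 1)) ^ u * expectation (\<lambda>\<omega>. V 0 (path \<omega>)) / (1/2) ^ k"
      by (rule contracting_maximal[OF con]) (auto simp: L_def)
    finally show ?thesis by (simp add: E_def)
  qed
  have "(\<lambda>u. (L / (real n - 1)) ^ u * E) \<longlonglongrightarrow> 0 * E"
    using n by (intro tendsto_mult_right LIMSEQ_realpow_zero) (auto simp: L_def field_simps)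
  then have "prob {\<omega> \<in> space M. \<forall>t. visits (path \<omega>) t v < k} \<le> 0"
    using le by (intro LIMSEQ_le_const[of _ 0]) auto
  then show ?thesis by (simp add: measure_le_0_iff)
qed

text \<open>From any vertex outside \<open>A\<close> the next step enters \<open>A\<close> with the
  same probability |A| / (n - 1), so the product formula is exact.\<close>

lemma expectation_avoid:
  assumes A: "A \<subseteq> {1..n}"
  shows "expectation (\<lambda>\<omega>. of_bool (\<forall>i\<le>t. X i \<omega> \<notin> A))
    = (1 - card A / n) * (1 - card A / (real n - 1)) ^ t"
proof (induction t)
  case 0
  have "expectation (\<lambda>\<omega>. of_bool (\<forall>i\<le>0. X i \<omega> \<notin> A)) = expectation (\<lambda>\<omega>. (\<lambda>y. if y \<in> A then 0 else if y \<in> {} then 0 else 1) (X 0 \<omega>))"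
    by (intro Bochner_Integration.integral_cong) auto
  also have "\<dots> = (\<Sum>y\<in>{1..n}. if y \<in> A then 0 else if y \<in> {} then 0 else 1) / n"
    by (rule expectation_start)
  also have "\<dots> = (real n - card A) / n"
    using sum_three[OF A, of "{}" 0 0 1] by simp
  finally show ?case using two_le_n by (simp add: diff_divide_distrib)
next
  case (Suc t)
  let ?F = "\<lambda>x. of_bool (\<forall>i\<le>Suc t. x i \<notin> A) :: real"
  have "adapted (Suc t) ?F" by (rule adapted_comp[OF adapted_avoid])
  from expectation_step[OF this]
  have "expectation (\<lambda>\<omega>. ?F (path \<omega>)) = expectation (\<lambda>\<omega>. (\<Sum>y\<in>{1..n} - {X t \<omega>}. ?F ((path \<omega>)(Suc t := y))) / (real n - 1))" .
  also have "\<dots> = expectation (\<lambda>\<omega>. (1 - card A / (real n - 1)) * of_bool (\<forall>i\<le>t. X i \<omega> \<notin> A))"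
  proof (intro Bochner_Integration.integral_cong refl)
    fix \<omega> assume \<omega>: "\<omega> \<in> space M"
    have "(\<Sum>y\<in>{1..n} - {X t \<omega>}. ?F ((path \<omega>)(Suc t := y)))
      = (\<Sum>y\<in>{1..n} - {X t \<omega>}. of_bool (\<forall>i\<le>t. X i \<omega> \<notin> A) * (if y \<in> A then 0 else if y \<in> {} then 0 else 1))"
      by (intro sum.cong refl) (auto simp: le_Suc_eq)
    also have "\<dots> = of_bool (\<forall>i\<le>t. X i \<omega> \<notin> A) * (real n - 1 - card A)"
      using X_range[OF \<omega>, of t] sum_three[OF A, of "{}" 0 0 1]
      by (auto simp: sum_distrib_left[symmetric] sum_diff1)
    finally show "(\<Sum>y\<in>{1..n} - {X t \<omega>}. ?F ((path \<omega>)(Suc t := y))) / (real n - 1)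
      = (1 - card A / (real n - 1)) * of_bool (\<forall>i\<le>t. X i \<omega> \<notin> A)"
      using two_le_n by (simp add: field_simps)
  qed
  finally show ?case using Suc by simp
qed

text \<open>Second moment method: \<open>\<mu>\<close> is the expected number of unvisited vertices.\<close>

lemma prob_covered_le:
  assumes n3: "3 \<le> n"
  shows "prob {\<omega> \<in> space M. \<forall>v\<in>{1..n}. \<exists>i\<le>t. X i \<omega> = v}
    \<le> 1 / ((real n - 1) * (1 - 1 / (real n - 1)) ^ t)"
proof -
  define q where "q = 1 - 1 / (real n - 1)"
  define \<mu> where "\<mu> = (real n - 1) * q ^ t"
  define I where "I = (\<lambda>v \<omega>. of_bool (\<forall>i\<le>t. X i \<omega> \<notin> {v}) :: real)"
  define N where "N = (\<lambda>\<omega>. \<Sum>v\<in>{1..n}. I v \<omega>)"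
  have q: "0 < q" using n3 by (simp add: q_def field_simps)
  have \<mu>: "0 < \<mu>" using n3 q by (simp add: \<mu>_def)
  have EI: "expectation (I v) = \<mu> / n" if "v \<in> {1..n}" for v
    using expectation_avoid[of "{v}" t] that n3 by (simp add: I_def \<mu>_def q_def field_simps)
  \<comment> \<open>The right-hand side times the number n(n - 1) of ordered pairs is mu^2, so the
    off-diagonal part of the second moment is at most mu^2 and the variance of \<open>N\<close> is
    at most mu.\<close>
  have EII: "expectation (\<lambda>\<omega>. I u \<omega> * I v \<omega>) \<le> \<mu>\<^sup>2 / n / (real n - 1)"
    if "u \<in> {1..n}" "v \<in> {1..n}" "u \<noteq> v" for u v
  proof -
    have "expectation (\<lambda>\<omega>. I u \<omega> * I v \<omega>) = expectation (\<lambda>\<omega>. of_bool (\<forall>i\<le>t. X i \<omega> \<notin> {u, v}))"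
      by (intro Bochner_Integration.integral_cong) (auto simp: I_def)
    also have "\<dots> = (1 - 2 / n) * (1 - 2 / (real n - 1)) ^ t"
      using expectation_avoid[of "{u, v}" t] that by simp
    also have "\<dots> \<le> (1 - 1 / n) * (q\<^sup>2) ^ t"
    proof (intro mult_mono power_mono)
      have "q\<^sup>2 = 1 - 2 / (real n - 1) + (1 / (real n - 1))\<^sup>2"
        by (simp add: q_def power2_eq_square algebra_simps)
      then show "1 - 2 / (real n - 1) \<le> q\<^sup>2" by simp
    qed (use n3 in \<open>auto simp: field_simps\<close>)
    also have "(q\<^sup>2) ^ t = (q ^ t)\<^sup>2" by (simp add: power_mult[symmetric] mult.commute)
    also have "(1 - 1 / n) * (q ^ t)\<^sup>2 = \<mu>\<^sup>2 / n / (real n - 1)"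
      using n3 by (simp add: \<mu>_def power2_eq_square divide_simps)
    finally show ?thesis .
  qed
  have iI: "integrable M (I v)" for v
    unfolding I_def
    by (rule integrable_adapted[of t "\<lambda>x. of_bool (\<forall>i\<le>t. x i \<notin> {v})"]) (rule adapted_comp[OF adapted_avoid])
  have iII: "integrable M (\<lambda>\<omega>. I u \<omega> * I v \<omega>)" for u v
    unfolding I_def
    by (rule integrable_adapted[of t "\<lambda>x. of_bool (\<forall>i\<le>t. x i \<notin> {u}) * of_bool (\<forall>i\<le>t. x i \<notin> {v})"])
      (rule adapted_comp2[OF adapted_avoid adapted_avoid])
  have EN: "expectation N = \<mu>"
    unfolding N_def using iI EI n3 by (subst Bochner_Integration.integral_sum) auto
  have NN: "N \<omega> * N \<omega> = (\<Sum>u\<in>{1..n}. \<Sum>v\<in>{1..n}. I u \<omega> * I v \<omega>)" for \<omega>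
    by (simp add: N_def sum_product)
  have iNN: "integrable M (\<lambda>\<omega>. N \<omega> * N \<omega>)" unfolding NN by (intro Bochner_Integration.integrable_sum iII)
  have iN: "integrable M N" unfolding N_def by (intro Bochner_Integration.integrable_sum iI)
  have "expectation (\<lambda>\<omega>. N \<omega> * N \<omega>) = (\<Sum>u\<in>{1..n}. \<Sum>v\<in>{1..n}. expectation (\<lambda>\<omega>. I u \<omega> * I v \<omega>))"
    unfolding NN using iII by (simp add: Bochner_Integration.integral_sum Bochner_Integration.integrable_sum)
  also have "\<dots> \<le> (\<Sum>u\<in>{1..n}. \<Sum>v\<in>{1..n}. if v = u then \<mu> / n else \<mu>\<^sup>2 / n / (real n - 1))"
  proof (intro sum_mono)
    fix u v assume uv: "u \<in> {1..n}" "v \<in> {1..n}"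
    have "(\<lambda>\<omega>. I u \<omega> * I u \<omega>) = I u" by (auto simp: I_def fun_eq_iff)
    then show "expectation (\<lambda>\<omega>. I u \<omega> * I v \<omega>) \<le> (if v = u then \<mu> / n else \<mu>\<^sup>2 / n / (real n - 1))"
      using EII[OF uv] EI[OF uv(1)] by (cases "v = u") auto
  qed
  also have "\<dots> = (\<Sum>u\<in>{1..n}. \<mu> / n + (real n - 1) * (\<mu>\<^sup>2 / n / (real n - 1)))"
  proof (rule sum.cong[OF refl])
    fix u assume "u \<in> {1..n}"
    then show "(\<Sum>v\<in>{1..n}. if v = u then \<mu> / n else \<mu>\<^sup>2 / n / (real n - 1)) = \<mu> / n + (real n - 1) * (\<mu>\<^sup>2 / n / (real n - 1))"
      using sum_three[of "{u}" n "{}" "\<mu> / n" 0 "\<mu>\<^sup>2 / n / (real n - 1)"] by (simp cong: if_cong)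
  qed
  also have "\<dots> = \<mu> + \<mu>\<^sup>2" using n3 by (simp add: field_simps)
  finally have ENN: "expectation (\<lambda>\<omega>. N \<omega> * N \<omega>) \<le> \<mu> + \<mu>\<^sup>2" .
  define C where "C = {\<omega> \<in> space M. \<forall>v\<in>{1..n}. \<exists>i\<le>t. X i \<omega> = v}"
  have C: "C \<in> sets M"
    unfolding C_def by (rule adapted_sets[OF adapted_covered])
  \<comment> \<open>Chebyshev's argument: \<open>N\<close> vanishes on \<open>C\<close>, hence mu^2
    is at most (N - mu)^2 there.\<close>
  have "\<mu>\<^sup>2 * prob C = expectation (\<lambda>\<omega>. \<mu>\<^sup>2 * indicator C \<omega>)"
    using sets.Int_space_eq2[OF C] by simp
  also have "\<dots> \<le> expectation (\<lambda>\<omega>. N \<omega> * N \<omega> - 2 * \<mu> * N \<omega> + \<mu>\<^sup>2)"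
  proof (rule integral_mono)
    show "integrable M (\<lambda>\<omega>. \<mu>\<^sup>2 * indicator C \<omega>)"
      using C by (intro integrable_mult_right integrable_real_indicator) (auto simp: emeasure_eq_measure)
    show "integrable M (\<lambda>\<omega>. N \<omega> * N \<omega> - 2 * \<mu> * N \<omega> + \<mu>\<^sup>2)"
      using iNN iN by (intro Bochner_Integration.integrable_add Bochner_Integration.integrable_diff integrable_mult_right) auto
    fix \<omega>
    have "N \<omega> = 0" if "\<omega> \<in> C" using that by (auto simp: C_def N_def I_def)
    moreover have "0 \<le> (N \<omega> - \<mu>)\<^sup>2" by simp
    ultimately show "\<mu>\<^sup>2 * indicator C \<omega> \<le> N \<omega> * N \<omega> - 2 * \<mu> * N \<omega> + \<mu>\<^sup>2"
      by (cases "\<omega> \<in> C") (auto simp: power2_eq_square algebra_simps)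
  qed
  also have "\<dots> = expectation (\<lambda>\<omega>. N \<omega> * N \<omega>) - 2 * \<mu> * expectation N + \<mu>\<^sup>2"
    using iNN iN by (simp add: Bochner_Integration.integral_add Bochner_Integration.integral_diff prob_space)
  also have "\<dots> \<le> \<mu>"
    using ENN EN by (simp add: power2_eq_square)
  finally have "\<mu> * (\<mu> * prob C) \<le> \<mu> * 1" by (simp add: power2_eq_square mult.assoc)
  then have "\<mu> * prob C \<le> 1" using \<mu> by (simp only: mult_le_cancel_left_pos)
  then show ?thesis
    unfolding C_def[symmetric] q_def[symmetric] \<mu>_def[symmetric] using \<mu> by (simp add: field_simps)
qed

end

section \<open>Union bound over vertex cuts\<close>

lemma visits_mono: "t \<le> t' \<Longrightarrow> visits x t v \<le> visits x t' v"
  unfolding visits_def by (intro card_mono finite_visits) auto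

lemma set_visits_eq_sum:
  assumes "finite A"
  shows "set_visits A x t = (\<Sum>v\<in>A. visits x t v)"
proof -
  have "{i. i \<le> t \<and> x i \<in> A} = (\<Union>v\<in>A. {i. i \<le> t \<and> x i = v})" by auto
  then show ?thesis
    unfolding set_visits_def visits_def using assms
    by (simp only: ) (subst card_UN_disjoint; auto simp: finite_visits)
qed

lemma separated_antimono: "separated A S x t' \<Longrightarrow> t \<le> t' \<Longrightarrow> separated A S x t"
  unfolding separated_def by auto

lemma first_time_finite:
  assumes "P t"
  obtains t where "first_time P = enat t" "P t" "\<And>s. P s \<Longrightarrow> t \<le> s"
proof -
  define m where "m = (LEAST t. P t)"
  have m: "P m" "\<And>s. P s \<Longrightarrow> m \<le> s"
    using assms by (auto simp: m_def intro: LeastI Least_le)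
  have "first_time P = enat m"
    by (rule enat_eqI) (use m in \<open>auto simp: first_time_le intro: order_trans\<close>)
  with m show ?thesis by (intro that)
qed

text \<open>The deterministic part, for a single trajectory: the probabilistic estimates enter as
  the absence of certain separated sets from time \<open>u\<close> on. Singletons come in two
  versions, with |S| <= 2k - 2 wherever the walk is, and with |S| <= 2k - 1 when the walk is off
  \<open>A\<close>.\<close>

lemma hitting_times_coincide_if_not_separated:
  assumes k: "1 \<le> k" "2 * k < n" and x: "\<And>i. x i \<in> {1..n}" and noloop: "\<And>i. x (Suc i) \<noteq> x i"
    and late: "\<not> (\<forall>v\<in>{1..n}. \<exists>i\<le>u. x i = v)"
    and recurrent: "\<And>v. v \<in> {1..n} \<Longrightarrow> \<exists>t. k \<le> visits x t v"
    and single: "\<And>A S t. u \<le> t \<Longrightarrow> A \<subseteq> {1..n} \<Longrightarrow> S \<subseteq> {1..n} \<Longrightarrow> A \<inter> S = {} \<Longrightarrow> card A = 1 \<Longrightarrow>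
      card S \<le> 2 * k - 2 \<Longrightarrow> separated A S x t \<Longrightarrow> \<not> k \<le> set_visits A x t"
    and single_left: "\<And>A S t. u \<le> t \<Longrightarrow> A \<subseteq> {1..n} \<Longrightarrow> S \<subseteq> {1..n} \<Longrightarrow> A \<inter> S = {} \<Longrightarrow> card A = 1 \<Longrightarrow>
      card S \<le> 2 * k - 1 \<Longrightarrow> separated A S x t \<Longrightarrow> x t \<notin> A \<Longrightarrow> \<not> k \<le> set_visits A x t"
    and large: "\<And>A S t. u \<le> t \<Longrightarrow> A \<subseteq> {1..n} \<Longrightarrow> S \<subseteq> {1..n} \<Longrightarrow> A \<inter> S = {} \<Longrightarrow> 2 \<le> card A \<Longrightarrow>
      2 * card A + card S \<le> n \<Longrightarrow> card S \<le> 2 * k - 1 \<Longrightarrow> separated A S x t \<Longrightarrow>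
      \<not> k * card A \<le> set_visits A x t"
  shows "tau_C n k x = tau_delta n (2 * k - 1) x \<and> tau_delta n (2 * k - 1) x = tau_kappa n (2 * k - 1) x \<and>
    tau_C n k x + 1 = tau_delta n (2 * k) x \<and> tau_delta n (2 * k) x = tau_kappa n (2 * k) x"
proof -
  from recurrent obtain T where T: "\<And>v. v \<in> {1..n} \<Longrightarrow> k \<le> visits x (T v) v" by metis
  have "\<forall>v\<in>{1..n}. k \<le> visits x (Max (T ` {1..n})) v"
    using T visits_mono[OF Max_ge[of "T ` {1..n}"]] by (meson finite_atLeastAtMost finite_imageI imageI order_trans)
  then obtain t where t: "tau_C n k x = enat t" "\<forall>v\<in>{1..n}. k \<le> visits x t v"
    unfolding tau_C_def by (rule first_time_finite)
  \<comment> \<open>Some vertex is unvisited at time \<open>u\<close>, and at tau_C every vertex has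
    been visited because k >= 1.\<close>
  have ut: "u \<le> t"
  proof (rule ccontr)
    assume "\<not> u \<le> t"
    have "\<exists>i\<le>u. x i = v" if "v \<in> {1..n}" for v
    proof -
      have "visits x t v \<noteq> 0" using t that k by fastforce
      then have "{i. i \<le> t \<and> x i = v} \<noteq> {}" unfolding visits_def by (metis card.empty)
      then obtain i where "i \<le> t" "x i = v" by blast
      with \<open>\<not> u \<le> t\<close> show ?thesis by (intro exI[of _ i]) auto
    qed
    with late show False by blast
  qed
  have sv: "k * card A \<le> set_visits A x t'" if A: "A \<subseteq> {1..n}" and "t \<le> t'" for A t'
  proof -
    have fA: "finite A" using A finite_subset by blast
    have "(\<Sum>v\<in>A. k) \<le> (\<Sum>v\<in>A. visits x t' v)"
      using t(2) A visits_mono[OF \<open>t \<le> t'\<close>] by (intro sum_mono) (meson order_trans subsetD)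
    then show ?thesis using fA by (simp add: set_visits_eq_sum mult.commute)
  qed
  show ?thesis
  proof (rule hitting_times_coincide[OF k t(1)])
    show "vertex_connected n (2 * k - 1) (trace x t)"
    proof (rule ccontr)
      assume "\<not> ?thesis"
      then obtain A S where AS: "A \<subseteq> {1..n}" "S \<subseteq> {1..n}" "A \<inter> S = {}" "A \<noteq> {}" "2 * card A + card S \<le> n"
        "card S < 2 * k - 1" "separated A S x t"
        by (rule not_connected_separated) (use k x in auto)
      have "card A \<noteq> 0" using AS finite_subset[OF AS(1)] by auto
      then consider "card A = 1" | "2 \<le> card A" by linarith
      then show False
      proof cases
        case 1
        then show False using single[OF ut AS(1-3)] AS sv[OF AS(1), of t] by simp
      next
        case 2
        then show False using large[OF ut AS(1-3)] AS sv[OF AS(1), of t] by simp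
      qed
    qed
    show "vertex_connected n (2 * k) (trace x (Suc t))"
    proof (rule ccontr)
      assume "\<not> ?thesis"
      then obtain A S where AS: "A \<subseteq> {1..n}" "S \<subseteq> {1..n}" "A \<inter> S = {}" "A \<noteq> {}" "2 * card A + card S \<le> n"
        "card S < 2 * k" "separated A S x (Suc t)"
        by (rule not_connected_separated) (use k x in auto)
      have ut': "u \<le> Suc t" using ut by simp
      have sep: "separated A S x t" using AS(7) by (rule separated_antimono) simp
      have "card A \<noteq> 0" using AS finite_subset[OF AS(1)] by auto
      then consider "card A = 1" | "2 \<le> card A" by linarith
      then show False
      proof cases
        case 1
        then obtain v where v: "A = {v}" by (auto simp: card_1_singleton_iff)
        \<comment> \<open>Without loops the walk is off the vertex at time \<open>t\<close> or at
          time \<open>Suc t\<close>. The k visits are present at both times, so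
          \<open>single_left\<close> applies at one of them.\<close>
        have "x t \<notin> A \<or> x (Suc t) \<notin> A" using noloop[of t] v by auto
        moreover have "card S \<le> 2 * k - 1" using AS(6) by simp
        ultimately show False
          using single_left[OF ut AS(1-3) 1 _ sep] single_left[OF ut' AS(1-3) 1 _ AS(7)] 1
            sv[OF AS(1), of t] sv[OF AS(1), of "Suc t"] by auto
      next
        case 2
        moreover have "card S \<le> 2 * k - 1" using AS(6) by simp
        ultimately show False using large[OF ut' AS(1-3)] AS sv[OF AS(1), of "Suc t"] by simp
      qed
    qed
  qed
qed

text \<open>The last condition, which makes \<open>A\<close> the smaller side, is kept because the
  estimate for large \<open>A\<close> relies on it.\<close>

definition separating_pairs :: "nat \<Rightarrow> nat \<Rightarrow> nat \<Rightarrow> (nat set \<times> nat set) set" where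
  "separating_pairs n a s = {(A, S). A \<subseteq> {1..n} \<and> S \<subseteq> {1..n} \<and> A \<inter> S = {} \<and> card A = a \<and> card S \<le> s \<and>
      2 * a + card S \<le> n}"

lemma finite_separating_pairs: "finite (separating_pairs n a s)"
  by (rule finite_subset[of _ "Pow {1..n} \<times> Pow {1..n}"]) (auto simp: separating_pairs_def)

text \<open>A set is coded by a list of length \<open>s\<close>, padded with 0, which is not a
  vertex.\<close>

lemma card_subsets_le: "card {S. S \<subseteq> {1..n::nat} \<and> card S \<le> s} \<le> (n + 1) ^ s"
proof -
  have "{S. S \<subseteq> {1..n} \<and> card S \<le> s} \<subseteq> (\<lambda>xs. set xs - {0}) ` {xs. set xs \<subseteq> {0..n} \<and> length xs = s}"
  proof
    fix S assume "S \<in> {S. S \<subseteq> {1..n} \<and> card S \<le> s}"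
    then have S: "S \<subseteq> {1..n}" "card S \<le> s" by auto
    define xs where "xs = sorted_list_of_set S @ replicate (s - card S) 0"
    have fS: "finite S" using S finite_subset by blast
    have "set xs - {0} = S" using S fS by (auto simp: xs_def)
    moreover have "set xs \<subseteq> {0..n}" "length xs = s" using S fS by (auto simp: xs_def)
    ultimately show "S \<in> (\<lambda>xs. set xs - {0}) ` {xs. set xs \<subseteq> {0..n} \<and> length xs = s}" by blast
  qed
  then have "card {S. S \<subseteq> {1..n} \<and> card S \<le> s} \<le> card {xs. set xs \<subseteq> {0..n} \<and> length xs = s}"
    by (rule surj_card_le[rotated]) (auto intro: finite_lists_length_eq)
  also have "\<dots> = (n + 1) ^ s" by (subst card_lists_length_eq) auto
  finally show ?thesis .
qed

section \<open>Union bounds and the choice of the weights by the size of A\<close>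

context complete_graph_walk
begin

text \<open>The transition rule excludes loops only up to a null set, while the deterministic part
  needs their absence on the trajectory.\<close>

lemma prob_no_loops: "prob {\<omega> \<in> space M. \<exists>t. X (Suc t) \<omega> = X t \<omega>} = 0"
proof -
  have ad: "adapted (Suc t) (\<lambda>x. x (Suc t) = x t)" for t by (rule adaptedI) auto
  have "prob {\<omega> \<in> space M. X (Suc t) \<omega> = X t \<omega>} = 0" for t
  proof -
    have "prob {\<omega> \<in> space M. X (Suc t) \<omega> = X t \<omega>} = expectation (indicator {\<omega> \<in> space M. X (Suc t) \<omega> = X t \<omega>})"
      using adapted_sets[OF ad] by (simp add: sets.Int_space_eq2)
    also have "\<dots> = expectation (\<lambda>\<omega>. of_bool (X (Suc t) \<omega> = X t \<omega>))"
      by (intro Bochner_Integration.integral_cong) (auto simp: indicator_def)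
    also have "\<dots> = expectation (\<lambda>\<omega>. (\<Sum>y\<in>{1..n} - {X t \<omega>}. of_bool (((path \<omega>)(Suc t := y)) (Suc t) = ((path \<omega>)(Suc t := y)) t)) / (real n - 1))"
      by (rule expectation_step[OF adapted_comp[OF ad]])
    also have "\<dots> = expectation (\<lambda>\<omega>. 0)"
      by (intro Bochner_Integration.integral_cong refl) (auto intro!: sum.neutral)
    finally show ?thesis by simp
  qed
  then have "{\<omega> \<in> space M. X (Suc t) \<omega> = X t \<omega>} \<in> null_sets M" for t
    using adapted_sets[OF ad] by (intro null_setsI) (simp_all add: emeasure_eq_measure)
  then have "(\<Union>t. {\<omega> \<in> space M. X (Suc t) \<omega> = X t \<omega>}) \<in> null_sets M" by (rule null_sets_UN)
  moreover have "(\<Union>t. {\<omega> \<in> space M. X (Suc t) \<omega> = X t \<omega>}) = {\<omega> \<in> space M. \<exists>t. X (Suc t) \<omega> = X t \<omega>}" by auto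
  ultimately show ?thesis by (simp add: null_sets_def measure_def)
qed

lemma prob_Union_separating_pairs_le:
  assumes E: "\<And>A S. E A S \<in> sets M"
    and b: "\<And>A S. A \<subseteq> {1..n} \<Longrightarrow> S \<subseteq> {1..n} \<Longrightarrow> A \<inter> S = {} \<Longrightarrow> card A = a \<Longrightarrow> card S \<le> s \<Longrightarrow>
      2 * a + card S \<le> n \<Longrightarrow> prob (E A S) \<le> \<beta>"
    and \<beta>: "0 \<le> \<beta>"
  shows "prob (\<Union>(A, S)\<in>separating_pairs n a s. E A S) \<le> real (n choose a) * (real n + 1) ^ s * \<beta>"
proof -
  define J where "J = separating_pairs n a s"
  let ?P = "{A. A \<subseteq> {1..n} \<and> card A = a} \<times> {S. S \<subseteq> {1..n} \<and> card S \<le> s}"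
  have fin: "finite ?P" by (intro finite_cartesian_product) (auto intro: finite_subset[of _ "Pow {1..n}"])
  have JP: "J \<subseteq> ?P" by (auto simp: J_def separating_pairs_def)
  then have fJ: "finite J" using fin by (rule finite_subset)
  have "card J \<le> card ?P" by (rule card_mono[OF fin JP])
  also have "\<dots> \<le> (n choose a) * (n + 1) ^ s"
    unfolding card_cartesian_product using card_subsets_le[of n s] by (simp add: n_subsets)
  finally have "real (card J) \<le> real ((n choose a) * (n + 1) ^ s)" by (rule of_nat_mono)
  then have cJ: "real (card J) \<le> real (n choose a) * (real n + 1) ^ s" by (simp add: add.commute)
  have "prob (\<Union>(A, S)\<in>J. E A S) \<le> (\<Sum>(A, S)\<in>J. prob (E A S))"
    using finite_measure_subadditive_finite[OF fJ, of "\<lambda>(A, S). E A S"] E by (auto simp: case_prod_unfold image_subset_iff)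
  also have "\<dots> \<le> (\<Sum>(A, S)\<in>J. \<beta>)" by (intro sum_mono) (auto simp: J_def separating_pairs_def intro!: b)
  also have "\<dots> = real (card J) * \<beta>" by (simp add: case_prod_unfold)
  also have "\<dots> \<le> real (n choose a) * (real n + 1) ^ s * \<beta>" by (intro mult_right_mono cJ \<beta>)
  finally show ?thesis by (simp add: J_def)
qed

text \<open>With d = n - 1 - L, the estimate 1 - x <= exp(-x) turns the decay up to time (1 - eps)
  (n - 1) ln n into a power of n. The exponent counts rest on this conversion.\<close>

lemma contraction_power_le:
  assumes d: "0 \<le> d" "d \<le> real n - 1" and u: "(1 - \<epsilon>) * (real n - 1) * ln n \<le> real u"
  shows "((real n - 1 - d) / (real n - 1)) ^ u \<le> real n powr (- (d * (1 - \<epsilon>)))"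
proof -
  have n: "real n - 1 > 0" "real n > 0" using two_le_n by auto
  have "((real n - 1 - d) / (real n - 1)) ^ u \<le> (exp (- d / (real n - 1))) ^ u"
  proof (rule power_mono)
    have "(real n - 1 - d) / (real n - 1) = 1 + (- d / (real n - 1))" using n by (simp add: field_simps)
    also have "\<dots> \<le> exp (- d / (real n - 1))" by (rule exp_ge_add_one_self)
    finally show "(real n - 1 - d) / (real n - 1) \<le> exp (- d / (real n - 1))" .
  qed (use d n in auto)
  also have "\<dots> = exp (- (d / (real n - 1) * real u))" by (simp add: exp_of_nat_mult[symmetric] mult.commute)
  also have "\<dots> \<le> exp (- (d / (real n - 1) * ((1 - \<epsilon>) * (real n - 1) * ln n)))"
    using mult_left_mono[OF u, of "d / (real n - 1)"] d n by (simp only: exp_le_cancel_iff neg_le_iff_le) simp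
  also have "d / (real n - 1) * ((1 - \<epsilon>) * (real n - 1) * ln n) = d * (1 - \<epsilon>) * ln n"
    using n by simp
  finally show ?thesis using n by (simp add: powr_def mult.commute)
qed

text \<open>Origin of the constants, with m = 2k - 1 >= |S|. From the single vertex of
  \<open>A\<close> the next vertex must lie in \<open>S\<close>, which has chance at most about m /
  n, hence hA = 4m / n. The excess eta of \<open>hS\<close> over 1 may cost |S| * eta <= 1/8 in the
  condition \<open>outside\<close>, which gives eta = 1/(8m) and L = n - 1 - 7/8. In the condition
  \<open>via\<close> this excess gains about eta * n; half of it is spent on z * hA = eta * n / 2,
  and so z has order n^2.\<close>

lemma prob_single_separated_le:
  assumes k: "1 \<le> k" "16 * k \<le> n" and \<epsilon>: "\<epsilon> \<le> 1/8" and u: "(1 - \<epsilon>) * (real n - 1) * ln n \<le> real u"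
    and AS: "A \<subseteq> {1..n}" "S \<subseteq> {1..n}" "A \<inter> S = {}" and a: "card A = 1" and s: "card S \<le> 2 * k - 1"
    and c: "0 < c"
  shows "prob {\<omega> \<in> space M. \<exists>t\<ge>u. separated A S (path \<omega>) t \<and> k \<le> set_visits A (path \<omega>) t
      \<and> c \<le> potential A S (4 * (2 * real k - 1) / n) (1 + 1 / (8 * (2 * real k - 1))) (X t \<omega>)}
    \<le> real n powr (- 3/4) * 3 / (((real n)\<^sup>2 / (64 * (2 * real k - 1)\<^sup>2)) ^ k * c)"
proof -
  define m where "m = 2 * real k - 1"
  define \<eta> where "\<eta> = 1 / (8 * m)"
  define z where "z = (real n)\<^sup>2 / (64 * m\<^sup>2)"
  define L where "L = real n - 1 - 7/8"
  have m: "1 \<le> m" "8 * m \<le> real n" "real (card S) \<le> m" using k s by (auto simp: m_def)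
  have n: "16 \<le> real n" using k by simp
  have \<eta>: "0 < \<eta>" "\<eta> \<le> 1/8" "m * \<eta> = 1/8" using m by (auto simp: \<eta>_def field_simps)
  have zh: "z * (4 * m / n) = \<eta> * n / 2"
    using m n by (simp add: z_def \<eta>_def power2_eq_square field_simps)
  have S\<eta>: "real (card S) * \<eta> \<le> 1/8" using mult_right_mono[OF m(3), of \<eta>] \<eta> by simp
  have "prob {\<omega> \<in> space M. \<exists>t\<ge>u. separated A S (path \<omega>) t \<and> k \<le> set_visits A (path \<omega>) t
      \<and> c \<le> potential A S (4 * m / n) (1 + \<eta>) (X t \<omega>)}
    \<le> (L / (real n - 1)) ^ u * (card A * z * (4 * m / n) / n + (1 + \<eta>)) / (z ^ k * c)"
  proof (rule prob_separated_le[OF AS])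
    have "(8 * m)\<^sup>2 \<le> (real n)\<^sup>2" using m by (intro power_mono) auto
    then show "1 \<le> z" using m by (simp add: z_def power_mult_distrib)
    show "real n - 1 - card A - card S + card S * (1 + \<eta>) \<le> L"
      using a S\<eta> by (simp add: L_def algebra_simps)
    have "real (card S) + real n / 2 \<le> L" using m n by (simp add: L_def)
    from mult_left_mono[OF this, of \<eta>] have "\<eta> * card S + \<eta> * n / 2 \<le> \<eta> * L"
      using \<eta> by (simp add: algebra_simps)
    moreover have "real n - 2 \<le> L" by (simp add: L_def)
    moreover have "real n - card A - card S + (real (card S) - 1) * (1 + \<eta>) + card A * z * (4 * m / n)
        = real n - 2 - \<eta> + \<eta> * card S + z * (4 * m / n)"
      using a by (simp add: algebra_simps)
    moreover have "L * (1 + \<eta>) = L + \<eta> * L" by (simp add: algebra_simps)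
    ultimately show "real n - card A - card S + (real (card S) - 1) * (1 + \<eta>) + card A * z * (4 * m / n) \<le> L * (1 + \<eta>)"
      using zh \<eta>(1) by linarith
    have "card S * (1 + \<eta>) \<le> m + 1/8 * m"
      using m \<eta> S\<eta> by (simp add: algebra_simps)
    also have "\<dots> \<le> (real n / 2) * (4 * m / n)" using n m by simp
    also have "\<dots> \<le> L * (4 * m / n)" using n m by (intro mult_right_mono) (auto simp: L_def)
    finally show "card S * (1 + \<eta>) + (real (card A) - 1) * z * (4 * m / n) \<le> L * (4 * m / n)"
      using a by simp
  qed (use m n \<eta> c in \<open>auto simp: L_def\<close>)
  also have "\<dots> \<le> real n powr (- 3/4) * 3 / (z ^ k * c)"
  proof (intro divide_right_mono mult_mono)
    have "(L / (real n - 1)) ^ u \<le> real n powr (- (7/8 * (1 - \<epsilon>)))"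
      unfolding L_def by (rule contraction_power_le[OF _ _ u]) (use n in auto)
    \<comment> \<open>For eps <= 1/8 the exponent 7/8 * (1 - eps) is at least 49/64, which exceeds
      3/4.\<close>
    also have "\<dots> \<le> real n powr (- 3/4)" using n \<epsilon> by (intro powr_mono) auto
    finally show "(L / (real n - 1)) ^ u \<le> real n powr (- 3/4)" .
    have "card A * z * (4 * m / n) / n = (z * (4 * m / n)) / n" using a by simp
    also have "\<dots> = \<eta> / 2" unfolding zh using n by simp
    finally have e: "card A * z * (4 * m / n) / n = \<eta> / 2" .
    show "card A * z * (4 * m / n) / n + (1 + \<eta>) \<le> 3" unfolding e using \<eta>(2) by simp
    show "0 \<le> card A * z * (4 * m / n) / n + (1 + \<eta>)" using \<eta> m by (simp add: z_def)
    show "0 \<le> z ^ k * c" using c by (simp add: z_def)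
  qed simp
  finally show ?thesis by (simp add: m_def \<eta>_def z_def)
qed

text \<open>For |A| > 1 steps within \<open>A\<close> also earn \<open>z\<close>, and the condition
  \<open>inside\<close> forces (|A| - 1) * z <= L. So hA = 1 is taken, and \<open>z\<close> is fixed
  by |A| * z = eta * n / 2, the same budget in the condition \<open>via\<close> as for singletons.
  The decay loses only the 1/8 caused by |S| * eta.\<close>

lemma prob_small_separated_le:
  assumes k: "1 \<le> k" "16 * k \<le> n" and u: "(1 - \<epsilon>) * (real n - 1) * ln n \<le> real u"
    and AS: "A \<subseteq> {1..n}" "S \<subseteq> {1..n}" "A \<inter> S = {}" and a: "1 \<le> card A" "32 * k * card A \<le> n"
    and s: "card S \<le> 2 * k - 1"
  shows "prob {\<omega> \<in> space M. \<exists>t\<ge>u. separated A S (path \<omega>) t \<and> k * card A \<le> set_visits A (path \<omega>) t}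
    \<le> real n powr (- ((card A - 1/8) * (1 - \<epsilon>))) * 3 / (real n / (16 * (2 * real k - 1) * card A)) ^ (k * card A)"
proof -
  define m where "m = 2 * real k - 1"
  define \<eta> where "\<eta> = 1 / (8 * m)"
  define z where "z = real n / (16 * m * card A)"
  define L where "L = real n - 1 - (card A - 1/8)"
  have m: "1 \<le> m" "8 * m \<le> real n" "real (card S) \<le> m" using k s by (auto simp: m_def)
  have mA: "16 * m * card A \<le> real n"
  proof -
    have "16 * m * card A \<le> 32 * real k * real (card A)"
      by (intro mult_right_mono) (auto simp: m_def)
    also have "\<dots> \<le> real n" using a(2) by (metis of_nat_le_iff of_nat_mult of_nat_numeral)
    finally show ?thesis .
  qed
  have A: "32 * real (card A) \<le> real n"
  proof -
    have "32 * 1 * card A \<le> 32 * k * card A" using k by (intro mult_le_mono) auto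
    with a(2) show ?thesis by linarith
  qed
  have A1: "1 \<le> real (card A)" using a by simp
  have n: "32 \<le> real n" using A A1 by linarith
  have \<eta>: "0 < \<eta>" "\<eta> \<le> 1/8" "m * \<eta> = 1/8" using m by (auto simp: \<eta>_def field_simps)
  have zh: "card A * z = \<eta> * n / 2"
    using m n A1 by (simp add: z_def \<eta>_def field_simps)
  have z1: "1 \<le> z" using mA m A1 by (simp add: z_def)
  have S\<eta>: "real (card S) * \<eta> \<le> 1/8" using mult_right_mono[OF m(3), of \<eta>] \<eta> by simp
  have "{\<omega> \<in> space M. \<exists>t\<ge>u. separated A S (path \<omega>) t \<and> k * card A \<le> set_visits A (path \<omega>) t}
    = {\<omega> \<in> space M. \<exists>t\<ge>u. separated A S (path \<omega>) t \<and> k * card A \<le> set_visits A (path \<omega>) t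
      \<and> 1 \<le> potential A S 1 (1 + \<eta>) (X t \<omega>)}"
    using \<eta> by (auto simp: potential_def)
  also have "prob \<dots> \<le> (L / (real n - 1)) ^ u * (card A * z * 1 / n + (1 + \<eta>)) / (z ^ (k * card A) * 1)"
  proof (rule prob_separated_le[OF AS z1])
    show "real n - 1 - card A - card S + card S * (1 + \<eta>) \<le> L"
      using S\<eta> by (simp add: L_def algebra_simps)
    have "real (card S) + real n / 2 \<le> L" using m n A by (simp add: L_def)
    from mult_left_mono[OF this, of \<eta>] have "\<eta> * card S + \<eta> * n / 2 \<le> \<eta> * L"
      using \<eta> by (simp add: algebra_simps)
    moreover have "real n - 1 - card A \<le> L" by (simp add: L_def)
    moreover have "real n - card A - card S + (real (card S) - 1) * (1 + \<eta>) + card A * z * 1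
        = real n - 1 - card A - \<eta> + \<eta> * card S + card A * z"
      by (simp add: algebra_simps)
    moreover have "L * (1 + \<eta>) = L + \<eta> * L" by (simp add: algebra_simps)
    ultimately show "real n - card A - card S + (real (card S) - 1) * (1 + \<eta>) + card A * z * 1 \<le> L * (1 + \<eta>)"
      using zh \<eta>(1) by linarith
    have "card S * (1 + \<eta>) + (real (card A) - 1) * z * 1 \<le> m + 1/8 + \<eta> * n / 2"
      using m S\<eta> zh z1 by (simp add: algebra_simps)
    also have "\<dots> \<le> m + 1/8 + n / 16" using mult_right_mono[OF \<eta>(2), of n] by simp
    also have "\<dots> \<le> L" using n m A by (simp add: L_def)
    finally show "card S * (1 + \<eta>) + (real (card A) - 1) * z * 1 \<le> L * 1" by simp
  qed (use n \<eta> A A1 in \<open>auto simp: L_def\<close>)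
  also have "\<dots> \<le> real n powr (- ((card A - 1/8) * (1 - \<epsilon>))) * 3 / (z ^ (k * card A) * 1)"
  proof (intro divide_right_mono mult_mono)
    show "(L / (real n - 1)) ^ u \<le> real n powr (- ((card A - 1/8) * (1 - \<epsilon>)))"
      unfolding L_def by (rule contraction_power_le[OF _ _ u]) (use n A A1 in auto)
    have e: "card A * z * 1 / n = \<eta> / 2" using zh n by simp
    show "card A * z * 1 / n + (1 + \<eta>) \<le> 3" unfolding e using \<eta>(2) by simp
    show "0 \<le> card A * z * 1 / n + (1 + \<eta>)" using \<eta> m z1 by simp
    show "0 \<le> z ^ (k * card A) * 1" using z1 by simp
  qed simp
  finally show ?thesis by (simp add: m_def z_def)
qed

text \<open>With z = 1 only the missing edges across the cut are exploited. From \<open>S\<close>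
  every move is allowed, so decay is possible there only if \<open>hS\<close> > 1. The value 3 costs
  at most 2m in \<open>L\<close> through the condition \<open>outside\<close>; the condition
  \<open>inside\<close> then follows from 2|A| + |S| <= n.\<close>

lemma prob_large_separated_le:
  assumes k: "1 \<le> k" and u: "(1 - \<epsilon>) * (real n - 1) * ln n \<le> real u"
    and AS: "A \<subseteq> {1..n}" "S \<subseteq> {1..n}" "A \<inter> S = {}" and a: "4 * k \<le> card A" "2 * card A + card S \<le> n"
    and s: "card S \<le> 2 * k - 1"
  shows "prob {\<omega> \<in> space M. \<exists>t\<ge>u. separated A S (path \<omega>) t \<and> v \<le> set_visits A (path \<omega>) t}
    \<le> real n powr (- ((real (card A) - 2 * (2 * real k - 1)) * (1 - \<epsilon>))) * 4"
proof -
  define m where "m = 2 * real k - 1"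
  define L where "L = real n - 1 - (card A - 2 * m)"
  have m: "1 \<le> m" "2 * m \<le> card A" "real (card S) \<le> m" using k s a by (auto simp: m_def)
  have A: "2 * real (card A) + real (card S) \<le> n" using a(2) by linarith
  have n: "2 \<le> real n" using two_le_n by simp
  have A1: "1 \<le> real (card A)" using m by linarith
  have ev: "{\<omega> \<in> space M. \<exists>t\<ge>u. separated A S (path \<omega>) t \<and> 0 \<le> set_visits A (path \<omega>) t
      \<and> 1 \<le> potential A S 1 3 (X t \<omega>)} = {\<omega> \<in> space M. \<exists>t\<ge>u. separated A S (path \<omega>) t}"
    by (auto simp: potential_def)
  have "prob {\<omega> \<in> space M. \<exists>t\<ge>u. separated A S (path \<omega>) t \<and> v \<le> set_visits A (path \<omega>) t}
      \<le> prob {\<omega> \<in> space M. \<exists>t\<ge>u. separated A S (path \<omega>) t}"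
    by (intro finite_measure_mono adapted_sets_Ex adapted_separated) auto
  also have "\<dots> = prob {\<omega> \<in> space M. \<exists>t\<ge>u. separated A S (path \<omega>) t \<and> 0 \<le> set_visits A (path \<omega>) t
      \<and> 1 \<le> potential A S 1 3 (X t \<omega>)}" unfolding ev ..
  also have "\<dots> \<le> (L / (real n - 1)) ^ u * (real (card A) * 1 * 1 / n + 3) / (1 ^ 0 * 1)"
    by (rule prob_separated_le[OF AS]) (use m n A A1 in \<open>auto simp: L_def algebra_simps\<close>)
  also have "\<dots> = (L / (real n - 1)) ^ u * (card A / n + 3)" by simp
  also have "\<dots> \<le> real n powr (- ((card A - 2 * m) * (1 - \<epsilon>))) * 4"
  proof (intro mult_mono)
    show "(L / (real n - 1)) ^ u \<le> real n powr (- ((card A - 2 * m) * (1 - \<epsilon>)))"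
      unfolding L_def by (rule contraction_power_le[OF _ _ u]) (use n m A A1 in auto)
    show "card A / n + 3 \<le> 4" using A n by simp
  qed (use A1 n in auto)
  finally show ?thesis by (simp add: m_def)
qed

end

section \<open>Asymptotics\<close>

lemma adapted_trace: "adapted t (\<lambda>x. trace x t)"
  unfolding trace_def
  by (rule adaptedI, rule image_mset_cong) (auto simp: Suc_le_eq)

lemma adapted_visits: "adapted t (\<lambda>x. visits x t v)"
  using adapted_set_visits[of t "{v}"] by (simp add: set_visits_def visits_def)

lemma adapted_first_time:
  assumes "\<And>t. adapted t (\<lambda>x. P x t)"
  shows "adapted t (\<lambda>x. first_time (P x) \<le> enat t)"
  unfolding first_time_le
  by (rule adaptedI, intro ex_cong1 conj_cong refl, rule adaptedD[OF assms]) auto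

lemma adapted_tau_C: "adapted t (\<lambda>x. tau_C n k x \<le> enat t)"
proof -
  have "adapted s (\<lambda>x. \<forall>v\<in>{1..n}. k \<le> visits x s v)" for s
    by (rule adaptedI, intro ball_cong refl) (metis adaptedD[OF adapted_visits])
  then show ?thesis unfolding tau_C_def by (rule adapted_first_time)
qed

lemma adapted_tau_delta: "adapted t (\<lambda>x. tau_delta n m x \<le> enat t)"
  unfolding tau_delta_def
  by (intro adapted_first_time adapted_comp[OF adapted_trace, of _ "\<lambda>G. spanning n G \<and> m \<le> min_simple_degree n G"])

lemma adapted_tau_kappa: "adapted t (\<lambda>x. tau_kappa n m x \<le> enat t)"
  unfolding tau_kappa_def
  by (intro adapted_first_time adapted_comp[OF adapted_trace, of _ "\<lambda>G. spanning n G \<and> vertex_connected n m G"])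

lemma adapted_tau_C_Suc: "adapted t (\<lambda>x. tau_C n k x + 1 \<le> enat t)"
proof (cases t)
  case 0
  have "\<not> tau_C n k x + 1 \<le> enat 0" for x
    by (cases "tau_C n k x") (auto simp: one_enat_def)
  then show ?thesis unfolding 0 by (simp add: adapted_def)
next
  case (Suc s)
  have "tau_C n k x + 1 \<le> enat t \<longleftrightarrow> tau_C n k x \<le> enat s" for x
    by (cases "tau_C n k x") (auto simp: Suc one_enat_def)
  then show ?thesis
    using adapted_mono[OF adapted_tau_C, of s t] Suc by simp
qed

context complete_graph_walk
begin

text \<open>Two extended naturals agree iff they compare alike with every finite time, which is a
  countable intersection of finite-history events.\<close>

lemma sets_stopping_eq:
  fixes f g :: "(nat \<Rightarrow> nat) \<Rightarrow> enat"
  assumes "\<And>t. adapted t (\<lambda>x. f x \<le> enat t)" "\<And>t. adapted t (\<lambda>x. g x \<le> enat t)"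
  shows "{\<omega> \<in> space M. f (path \<omega>) = g (path \<omega>)} \<in> sets M"
proof -
  have "{\<omega> \<in> space M. f (path \<omega>) = g (path \<omega>)}
      = {\<omega> \<in> space M. \<forall>t. (f (path \<omega>) \<le> enat t) = (g (path \<omega>) \<le> enat t)}"
    unfolding enat_eq_iff ..
  also have "\<dots> \<in> sets M"
    by (intro sets.sets_Collect_countable_All adapted_sets[OF adapted_comp2[OF assms, of _ "(=)"]])
  finally show ?thesis .
qed

lemma sets_hitting_times_coincide:
  "{\<omega> \<in> space M.
      tau_C n k (\<lambda>t. X t \<omega>) = tau_delta n (2 * k - 1) (\<lambda>t. X t \<omega>) \<and>
      tau_delta n (2 * k - 1) (\<lambda>t. X t \<omega>) = tau_kappa n (2 * k - 1) (\<lambda>t. X t \<omega>) \<and>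
      tau_C n k (\<lambda>t. X t \<omega>) + 1 = tau_delta n (2 * k) (\<lambda>t. X t \<omega>) \<and>
      tau_delta n (2 * k) (\<lambda>t. X t \<omega>) = tau_kappa n (2 * k) (\<lambda>t. X t \<omega>)} \<in> sets M"
  by (intro sets.sets_Collect_conj sets_stopping_eq adapted_tau_C adapted_tau_delta adapted_tau_kappa
      adapted_tau_C_Suc)

text \<open>The second moment bound is the reciprocal of the mean number of unvisited vertices. The
  estimate ln(1 - y) >= - y - 2 y^2 at y = 1 / (n - 1) bounds this mean below by a quantity of order
  n^eps.\<close>

lemma prob_covered_early_le:
  assumes n: "3 \<le> n" and u: "real u \<le> (1 - \<epsilon>) * (real n - 1) * ln n + 1"
  shows "prob {\<omega> \<in> space M. \<forall>v\<in>{1..n}. \<exists>i\<le>u. X i \<omega> = v}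
    \<le> exp (((1 - \<epsilon>) * (real n - 1) * ln n + 1) * (1 / (real n - 1) + 2 * (1 / (real n - 1))\<^sup>2)) / (real n - 1)"
proof -
  define y where "y = 1 / (real n - 1)"
  have y: "0 < y" "y \<le> 1/2" using n by (auto simp: y_def field_simps)
  have "exp (- (((1 - \<epsilon>) * (real n - 1) * ln n + 1) * (y + 2 * y\<^sup>2))) \<le> exp (- (real u * (y + 2 * y\<^sup>2)))"
    using u y by (intro exp_le_cancel_iff[THEN iffD2] le_imp_neg_le mult_right_mono) auto
  also have "\<dots> = exp (- y - 2 * y\<^sup>2) ^ u"
    by (simp add: exp_of_nat_mult[symmetric] algebra_simps)
  also have "\<dots> \<le> exp (ln (1 - y)) ^ u"
    using ln_one_minus_pos_lower_bound[of y] y by (intro power_mono exp_le_cancel_iff[THEN iffD2]) auto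
  also have "\<dots> = (1 - y) ^ u" using y by simp
  finally have *: "exp (- (((1 - \<epsilon>) * (real n - 1) * ln n + 1) * (y + 2 * y\<^sup>2))) \<le> (1 - y) ^ u" .
  have "prob {\<omega> \<in> space M. \<forall>v\<in>{1..n}. \<exists>i\<le>u. X i \<omega> = v} \<le> 1 / ((real n - 1) * (1 - y) ^ u)"
    using prob_covered_le[OF n, of u] by (simp add: y_def)
  also have "\<dots> \<le> 1 / ((real n - 1) * exp (- (((1 - \<epsilon>) * (real n - 1) * ln n + 1) * (y + 2 * y\<^sup>2))))"
    using * n y by (intro divide_left_mono mult_left_mono mult_pos_pos zero_less_power) auto
  also have "\<dots> = exp (((1 - \<epsilon>) * (real n - 1) * ln n + 1) * (y + 2 * y\<^sup>2)) / (real n - 1)"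
  proof -
    have "1 / (p * exp (- w)) = exp w / p" for p w :: real
      by (simp add: exp_minus field_simps)
    then show ?thesis .
  qed
  finally show ?thesis by (simp add: y_def)
qed

end

section \<open>Exponent counts for the union bounds\<close>

lemma Suc_power_le: "1 \<le> n \<Longrightarrow> (real n + 1) ^ s \<le> 2 ^ s * real n ^ s"
  unfolding power_mult_distrib[symmetric] by (intro power_mono) auto

lemma choose_le_power: "real (n choose a) \<le> real n ^ a / fact a"
proof -
  have "real ((n choose a) * fact a) \<le> real (n ^ a)" by (rule of_nat_mono[OF binomial_fact_pow])
  then show ?thesis by (simp add: pos_le_divide_eq)
qed

text \<open>The exponent of n is a + (2k - 1) from the choice of the sets, minus (a - 1/8)(1 - eps)
  from the decay, minus (1 - 3 eps) k a from the visits; in 3 eps, one eps absorbs 16(2k - 1) and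
  two bound a. The choice k * eps = 1/32 keeps the losses a * eps + 3 eps k a below a/8. What
  remains is at most 2k - 7/8 - (k - 1/8) a, which is -5/8 at a = 2. At a = 1 it would be positive,
  and so singletons need their own weight.\<close>

lemma small_sets_bound:
  fixes \<epsilon> :: real
  assumes k: "1 \<le> k" and \<epsilon>: "\<epsilon> = 1 / (32 * real k)" and n: "1 \<le> n" "16 * (2 * real k - 1) \<le> real n powr \<epsilon>"
    and a: "2 \<le> a" "real a \<le> real n powr (2 * \<epsilon>)"
  shows "real (n choose a) * (real n + 1) ^ (2 * k - 1) *
      (real n powr (- ((a - 1/8) * (1 - \<epsilon>))) * 3 / (real n / (16 * (2 * real k - 1) * a)) ^ (k * a))
    \<le> 3 * 2 ^ (2 * k - 1) * real n powr (- 5/8)"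
proof -
  have n0: "0 < real n" using n by simp
  have k1: "1 \<le> real k" using k by simp
  have \<epsilon>0: "0 < \<epsilon>" "\<epsilon> \<le> 1/32" "k * \<epsilon> = 1/32" using k1 by (auto simp: \<epsilon> field_simps)
  have a0: "0 < real a" using a by simp
  have m0: "0 < 2 * real k - 1" using k1 by simp
  have c: "real (n choose a) \<le> real n powr a"
  proof -
    have "real (n choose a) \<le> real n ^ a / fact a" by (rule choose_le_power)
    also have "\<dots> \<le> real n ^ a / 1" by (intro divide_left_mono) auto
    finally show ?thesis using n0 by (simp add: powr_realpow)
  qed
  have p: "(real n + 1) ^ (2 * k - 1) \<le> 2 ^ (2 * k - 1) * real n powr (2 * real k - 1)"
    using Suc_power_le[OF n(1), of "2 * k - 1"] n0 k by (simp add: powr_realpow[symmetric] of_nat_diff)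
  have "16 * (2 * real k - 1) * a \<le> real n powr \<epsilon> * real n powr (2 * \<epsilon>)"
    using n a m0 by (intro mult_mono) auto
  also have "\<dots> = real n powr (3 * \<epsilon>)" by (simp add: powr_add[symmetric])
  finally have d: "16 * (2 * real k - 1) * a \<le> real n powr (3 * \<epsilon>)" .
  have "real n powr (1 - 3 * \<epsilon>) = real n / real n powr (3 * \<epsilon>)" using n0 by (simp add: powr_diff)
  also have "\<dots> \<le> real n / (16 * (2 * real k - 1) * a)"
    using d n0 a0 m0 by (intro divide_left_mono) auto
  finally have "(real n powr (1 - 3 * \<epsilon>)) ^ (k * a) \<le> (real n / (16 * (2 * real k - 1) * a)) ^ (k * a)"
    by (intro power_mono) auto
  moreover have "(real n powr (1 - 3 * \<epsilon>)) ^ (k * a) = real n powr ((1 - 3 * \<epsilon>) * (k * a))"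
    using n0 by (simp add: powr_realpow[symmetric] powr_powr)
  ultimately have z: "real n powr ((1 - 3 * \<epsilon>) * (k * a)) \<le> (real n / (16 * (2 * real k - 1) * a)) ^ (k * a)"
    by simp
  have "real (n choose a) * (real n + 1) ^ (2 * k - 1) *
      (real n powr (- ((a - 1/8) * (1 - \<epsilon>))) * 3 / (real n / (16 * (2 * real k - 1) * a)) ^ (k * a))
    \<le> real n powr a * (2 ^ (2 * k - 1) * real n powr (2 * real k - 1)) *
      (real n powr (- ((a - 1/8) * (1 - \<epsilon>))) * 3 / real n powr ((1 - 3 * \<epsilon>) * (k * a)))"
    using n0 m0 a0 by (intro mult_mono divide_left_mono c p z) auto
  also have "\<dots> = 3 * 2 ^ (2 * k - 1) *
      real n powr (a + (2 * real k - 1) + - ((a - 1/8) * (1 - \<epsilon>)) - (1 - 3 * \<epsilon>) * (k * a))"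
  proof -
    have "x powr p * (c * x powr q) * (x powr r * 3 / x powr w) = 3 * c * x powr (p + q + r - w)"
      for x p q r w c :: real by (simp add: powr_add powr_diff)
    then show ?thesis .
  qed
  also have "\<dots> \<le> 3 * 2 ^ (2 * k - 1) * real n powr (- 5/8)"
  proof (intro mult_left_mono powr_mono)
    have "real a * \<epsilon> \<le> real a * (k * \<epsilon>)" using \<epsilon>0 a0 k1 by (intro mult_left_mono) auto
    then have 1: "real a * \<epsilon> \<le> a / 32" by (simp add: \<epsilon>0(3))
    have 2: "\<epsilon> * (k * a) = a / 32" using \<epsilon>0(3) by (simp add: mult.commute mult.left_commute)
    have "(real k - 1/8) * 2 \<le> (real k - 1/8) * a" using a k1 by (intro mult_left_mono) auto
    then have 3: "2 * real k - 1/4 \<le> k * a - a / 8" by (simp add: algebra_simps)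
    have "a + (2 * real k - 1) + - ((a - 1/8) * (1 - \<epsilon>)) - (1 - 3 * \<epsilon>) * (k * a)
      = 2 * real k - 1 + a * \<epsilon> + 1/8 - \<epsilon> / 8 - k * a + 3 * (\<epsilon> * (k * a))" by (simp add: field_simps)
    also have "\<dots> \<le> - 5/8" using 1 2 3 \<epsilon>0(1) by linarith
    finally show "a + (2 * real k - 1) + - ((a - 1/8) * (1 - \<epsilon>)) - (1 - 3 * \<epsilon>) * (k * a) \<le> - 5/8" .
  qed (use n in auto)
  finally show ?thesis .
qed

text \<open>The choice of \<open>A\<close> and the decay leave an excess of n^(eps a). Since a! >=
  (a/e)^a and a >= n^(2 eps), the factorial gains n^(-2 eps a), of which n^(eps a / 2) pays for e^a.
  The net exponent 3m - 2 m eps - eps a / 2 is pushed below -2 by the lower bound on n^(2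
  eps).\<close>

lemma large_sets_bound:
  fixes \<epsilon> :: real
  assumes k: "1 \<le> k" and \<epsilon>: "0 < \<epsilon>" "\<epsilon> \<le> 1" and n: "1 \<le> n" "2 \<le> \<epsilon> * ln n"
      "(6 * real k + 2) * 2 / \<epsilon> \<le> real n powr (2 * \<epsilon>)"
    and a: "real n powr (2 * \<epsilon>) \<le> real a"
  shows "real (n choose a) * (real n + 1) ^ (2 * k - 1) *
      (real n powr (- ((real a - 2 * (2 * real k - 1)) * (1 - \<epsilon>))) * 4)
    \<le> 4 * 2 ^ (2 * k - 1) * real n powr (- 2)"
proof -
  define m where "m = 2 * real k - 1"
  have n0: "0 < real n" using n by simp
  have k1: "1 \<le> real k" using k by simp
  have m: "1 \<le> m" using k1 by (simp add: m_def)
  have "0 < real n powr (2 * \<epsilon>)" using n0 by simp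
  then have a0: "0 < real a" using a by linarith
  \<comment> \<open>A single term of the exponential series at a already gives this form of
    Stirling's bound.\<close>
  have "real a ^ a / fact a \<le> exp (real a)"
  proof -
    have "(\<Sum>i\<in>{a}. real a ^ i /\<^sub>R fact i) \<le> (\<Sum>i. real a ^ i /\<^sub>R fact i)"
      by (intro sum_le_suminf summable_exp_generic) auto
    then show ?thesis by (simp add: exp_def divide_inverse mult.commute)
  qed
  then have f: "1 / fact a \<le> exp a / real a ^ a" using a0 by (simp add: field_simps)
  have "(real n powr (2 * \<epsilon>)) ^ a \<le> real a ^ a" using a by (intro power_mono) auto
  then have "exp a / real a ^ a \<le> exp a / (real n powr (2 * \<epsilon>)) ^ a"
    using n0 a0 by (intro divide_left_mono) auto
  also have "(real n powr (2 * \<epsilon>)) ^ a = real n powr (2 * \<epsilon> * a)"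
    using n0 by (simp add: powr_realpow[symmetric] powr_powr)
  also have "exp a / real n powr (2 * \<epsilon> * a) \<le> real n powr (\<epsilon> * a / 2) / real n powr (2 * \<epsilon> * a)"
  proof (intro divide_right_mono)
    have "2 * real a \<le> \<epsilon> * ln n * a" using n a0 by (intro mult_right_mono) auto
    then show "exp (real a) \<le> real n powr (\<epsilon> * a / 2)" using n0 by (simp add: powr_def mult_ac)
  qed simp
  also have "\<dots> = real n powr (- (3/2) * \<epsilon> * a)" by (simp add: powr_diff[symmetric] mult.assoc)
  finally have f': "1 / fact a \<le> real n powr (- (3/2) * \<epsilon> * a)" using f by linarith
  have c: "real (n choose a) \<le> real n powr a * real n powr (- (3/2) * \<epsilon> * a)"
  proof -
    have "real (n choose a) \<le> real n ^ a * (1 / fact a)" using choose_le_power[of n a] by simp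
    also have "\<dots> \<le> real n ^ a * real n powr (- (3/2) * \<epsilon> * a)" by (intro mult_left_mono f') auto
    finally show ?thesis using n0 by (simp add: powr_realpow)
  qed
  have p: "(real n + 1) ^ (2 * k - 1) \<le> 2 ^ (2 * k - 1) * real n powr m"
    using Suc_power_le[OF n(1), of "2 * k - 1"] n0 k by (simp add: powr_realpow[symmetric] of_nat_diff m_def)
  have "real (n choose a) * (real n + 1) ^ (2 * k - 1) * (real n powr (- ((real a - 2 * m) * (1 - \<epsilon>))) * 4)
    \<le> (real n powr a * real n powr (- (3/2) * \<epsilon> * a)) * (2 ^ (2 * k - 1) * real n powr m) *
      (real n powr (- ((real a - 2 * m) * (1 - \<epsilon>))) * 4)"
    by (intro mult_mono c p) auto
  also have "\<dots> = 4 * 2 ^ (2 * k - 1) *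
      real n powr (a + (- (3/2) * \<epsilon> * a) + m + (- ((real a - 2 * m) * (1 - \<epsilon>))))"
    by (simp only: powr_add) (simp only: mult_ac)
  also have "\<dots> \<le> 4 * 2 ^ (2 * k - 1) * real n powr (- 2)"
  proof (intro mult_left_mono powr_mono)
    have "(6 * real k + 2) * 2 / \<epsilon> * \<epsilon> \<le> real a * \<epsilon>" using n(3) a \<epsilon> by (intro mult_right_mono) auto
    then have "(6 * real k + 2) * 2 \<le> \<epsilon> * a" using \<epsilon> by (simp add: mult.commute)
    moreover have "0 \<le> m * \<epsilon>" using m \<epsilon> by simp
    moreover have "a + (- (3/2) * \<epsilon> * a) + m + (- ((real a - 2 * m) * (1 - \<epsilon>)))
        = 3 * m - 2 * (m * \<epsilon>) - \<epsilon> * a / 2" by (simp add: algebra_simps)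
    ultimately show "a + (- (3/2) * \<epsilon> * a) + m + (- ((real a - 2 * m) * (1 - \<epsilon>))) \<le> - 2"
      by (simp add: m_def)
  qed (use n in auto)
  finally show ?thesis by (simp add: m_def)
qed

text \<open>Both counts balance exactly up to constants. The factor z^k is of order n^(2k) and
  cancels n * n^(2k - 1); with one vertex fewer in \<open>S\<close>, the level 4m / n costs the
  factor n that was saved. Only the decay n^(-3/4) remains.\<close>

lemma singles_bound:
  assumes k: "1 \<le> k" and n: "1 \<le> n"
  shows "real (n choose 1) * (real n + 1) ^ (2 * k - 1) *
      (real n powr (- 3/4) * 3 / (((real n)\<^sup>2 / (64 * (2 * real k - 1)\<^sup>2)) ^ k * 1))
    \<le> 3 * 2 ^ (2 * k - 1) * (64 * (2 * real k - 1)\<^sup>2) ^ k * real n powr (- 3/4)"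
    and "real (n choose 1) * (real n + 1) ^ (2 * k - 2) *
      (real n powr (- 3/4) * 3 / (((real n)\<^sup>2 / (64 * (2 * real k - 1)\<^sup>2)) ^ k * (4 * (2 * real k - 1) / n)))
    \<le> 3 * 2 ^ (2 * k - 1) * (64 * (2 * real k - 1)\<^sup>2) ^ k * real n powr (- 3/4)"
proof -
  define m where "m = 2 * real k - 1"
  have n0: "1 \<le> real n" "0 < real n" using n by auto
  have m: "1 \<le> m" using k by (simp add: m_def)
  obtain j where j: "k = Suc j" using k by (cases k) auto
  have zk: "((real n)\<^sup>2 / (64 * m\<^sup>2)) ^ k = real n ^ (2 * k) / (64 * m\<^sup>2) ^ k"
    by (simp add: power_divide power_mult)
  define C where "C = (64 * m\<^sup>2) ^ k"
  define w where "w = real n powr (- 3/4)"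
  have C: "0 < C" using m by (simp add: C_def)
  have w: "0 \<le> w" by (simp add: w_def)
  have p1: "(real n + 1) ^ (2 * k - 1) \<le> 2 ^ (2 * k - 1) * real n ^ (2 * k - 1)"
    and p2: "(real n + 1) ^ (2 * k - 2) \<le> 2 ^ (2 * k - 2) * real n ^ (2 * k - 2)"
    by (rule Suc_power_le[OF n])+
  have "real n * (real n + 1) ^ (2 * k - 1) * (w * 3 / (real n ^ (2 * k) / C * 1))
    \<le> real n * (2 ^ (2 * k - 1) * real n ^ (2 * k - 1)) * (w * 3 / (real n ^ (2 * k) / C * 1))"
    using C w n0 by (intro mult_right_mono mult_left_mono p1) auto
  also have "\<dots> = 3 * 2 ^ (2 * k - 1) * C * w"
    using n0 C by (simp add: j field_simps)
  finally show "real (n choose 1) * (real n + 1) ^ (2 * k - 1) *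
      (real n powr (- 3/4) * 3 / (((real n)\<^sup>2 / (64 * (2 * real k - 1)\<^sup>2)) ^ k * 1))
    \<le> 3 * 2 ^ (2 * k - 1) * (64 * (2 * real k - 1)\<^sup>2) ^ k * real n powr (- 3/4)"
    unfolding m_def[symmetric] zk C_def[symmetric] w_def[symmetric] by simp
  have "real n * (real n + 1) ^ (2 * k - 2) * (w * 3 / (real n ^ (2 * k) / C * (4 * m / n)))
    \<le> real n * (2 ^ (2 * k - 2) * real n ^ (2 * k - 2)) * (w * 3 / (real n ^ (2 * k) / C * (4 * m / n)))"
    using C w n0 m by (intro mult_right_mono mult_left_mono p2) auto
  also have "\<dots> = (3 * 2 ^ (2 * k - 2) * C * w) / (4 * m)"
    using n0 C m by (simp add: j field_simps)
  also have "\<dots> \<le> (3 * 2 ^ (2 * k - 2) * C * w) / 1"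
    using C w m by (intro divide_left_mono) auto
  also have "\<dots> \<le> 3 * 2 ^ (2 * k - 1) * C * w"
    using C w by (simp add: mult_right_mono)
  finally show "real (n choose 1) * (real n + 1) ^ (2 * k - 2) *
      (real n powr (- 3/4) * 3 / (((real n)\<^sup>2 / (64 * (2 * real k - 1)\<^sup>2)) ^ k * (4 * (2 * real k - 1) / n)))
    \<le> 3 * 2 ^ (2 * k - 1) * (64 * (2 * real k - 1)\<^sup>2) ^ k * real n powr (- 3/4)"
    unfolding m_def[symmetric] zk C_def[symmetric] w_def[symmetric] by simp
qed

section \<open>Assembly of the estimates at fixed n\<close>

context complete_graph_walk
begin

text \<open>The walks for different n live on unrelated probability spaces. An explicit bound for
  each large n reduces the theorem to the limit of a numerical sequence.\<close>

lemma prob_not_coincide_le: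
  assumes k: "1 \<le> k" and \<epsilon>: "\<epsilon> = 1 / (32 * real k)"
    and n: "16 * real k \<le> real n" "16 * (2 * real k - 1) \<le> real n powr \<epsilon>"
      "32 * real k * real n powr (2 * \<epsilon>) \<le> n" "4 * real k \<le> real n powr (2 * \<epsilon>)" "2 \<le> \<epsilon> * ln n"
      "(6 * real k + 2) * 2 / \<epsilon> \<le> real n powr (2 * \<epsilon>)"
  shows "1 - (exp (((1 - \<epsilon>) * (real n - 1) * ln n + 1) * (1 / (real n - 1) + 2 * (1 / (real n - 1))\<^sup>2)) / (real n - 1)
      + 2 * (3 * 2 ^ (2 * k - 1) * (64 * (2 * real k - 1)\<^sup>2) ^ k * real n powr (- 3/4))
      + (real n powr (2 * \<epsilon>) * (3 * 2 ^ (2 * k - 1) * real n powr (- 5/8)) + n * (4 * 2 ^ (2 * k - 1) * real n powr (- 2))))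
    \<le> prob {\<omega> \<in> space M.
      tau_C n k (\<lambda>t. X t \<omega>) = tau_delta n (2 * k - 1) (\<lambda>t. X t \<omega>) \<and>
      tau_delta n (2 * k - 1) (\<lambda>t. X t \<omega>) = tau_kappa n (2 * k - 1) (\<lambda>t. X t \<omega>) \<and>
      tau_C n k (\<lambda>t. X t \<omega>) + 1 = tau_delta n (2 * k) (\<lambda>t. X t \<omega>) \<and>
      tau_delta n (2 * k) (\<lambda>t. X t \<omega>) = tau_kappa n (2 * k) (\<lambda>t. X t \<omega>)}"
proof -
  define u where "u = nat \<lceil>(1 - \<epsilon>) * (real n - 1) * ln n\<rceil>"
  define m where "m = 2 * real k - 1"
  define w where "w = (1 - \<epsilon>) * (real n - 1) * ln n"
  have nk: "16 * k \<le> n" using n(1) by linarith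
  then have n3: "3 \<le> n" and n1: "1 \<le> n" using k by linarith+
  have \<epsilon>1: "0 < \<epsilon>" "\<epsilon> \<le> 1/32" using k by (auto simp: \<epsilon> field_simps)
  have w0: "0 \<le> w" using n3 \<epsilon>1 by (simp add: w_def)
  \<comment> \<open>The decay estimates need \<open>u\<close> bounded from below and the estimate of
    an early cover needs it bounded from above; rounding up costs the + 1.\<close>
  have u: "w \<le> real u" "real u \<le> w + 1"
    using w0 unfolding u_def w_def[symmetric] by linarith+
  have m: "1 \<le> m" "4 * m \<le> n" using k n(1) by (auto simp: m_def)
  define G where "G = {\<omega> \<in> space M.
      tau_C n k (\<lambda>t. X t \<omega>) = tau_delta n (2 * k - 1) (\<lambda>t. X t \<omega>) \<and>
      tau_delta n (2 * k - 1) (\<lambda>t. X t \<omega>) = tau_kappa n (2 * k - 1) (\<lambda>t. X t \<omega>) \<and>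
      tau_C n k (\<lambda>t. X t \<omega>) + 1 = tau_delta n (2 * k) (\<lambda>t. X t \<omega>) \<and>
      tau_delta n (2 * k) (\<lambda>t. X t \<omega>) = tau_kappa n (2 * k) (\<lambda>t. X t \<omega>)}"
  define C where "C = {\<omega> \<in> space M. \<forall>v\<in>{1..n}. \<exists>i\<le>u. X i \<omega> = v}"
  define R where "R = (\<Union>v\<in>{1..n}. {\<omega> \<in> space M. \<forall>t. visits (path \<omega>) t v < k})"
  define N where "N = {\<omega> \<in> space M. \<exists>t. X (Suc t) \<omega> = X t \<omega>}"
  define E1 where "E1 = (\<lambda>c A S. {\<omega> \<in> space M. \<exists>t\<ge>u. separated A S (path \<omega>) t \<and>
    k \<le> set_visits A (path \<omega>) t \<and> c \<le> potential A S (4 * m / n) (1 + 1 / (8 * m)) (X t \<omega>)})"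
  define E2 where "E2 = (\<lambda>A S. {\<omega> \<in> space M. \<exists>t\<ge>u. separated A S (path \<omega>) t \<and>
    k * card A \<le> set_visits A (path \<omega>) t})"
  \<comment> \<open>Since 4m / n <= 1, this level is the least value of the potential and leaves the
    position of the walk free. The level 1 in \<open>U'\<close> is met as soon as the walk is off
    \<open>A\<close>.\<close>
  define U where "U = (\<Union>(A, S)\<in>separating_pairs n 1 (2 * k - 2). E1 (4 * m / n) A S)"
  define U' where "U' = (\<Union>(A, S)\<in>separating_pairs n 1 (2 * k - 1). E1 1 A S)"
  define W where "W = (\<lambda>a. \<Union>(A, S)\<in>separating_pairs n a (2 * k - 1). E2 A S)"
  have E1s: "E1 c A S \<in> sets M" for c A S
    unfolding E1_def
    by (rule adapted_sets_Ex[of "\<lambda>t x. separated A S x t \<and> k \<le> set_visits A x t \<and> c \<le> potential A S (4 * m / n) (1 + 1 / (8 * m)) (x t)"],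
        intro adapted_comp2[of _ _ _ "(\<and>)"] adapted_separated adapted_comp[OF adapted_set_visits] adapted_coord)
  have E2s: "E2 A S \<in> sets M" for A S
    unfolding E2_def
    by (rule adapted_sets_Ex[of "\<lambda>t x. separated A S x t \<and> k * card A \<le> set_visits A x t"],
        intro adapted_comp2[of _ _ _ "(\<and>)"] adapted_separated adapted_comp[OF adapted_set_visits])
  have Gs: "G \<in> sets M" unfolding G_def by (rule sets_hitting_times_coincide)
  have Cs: "C \<in> sets M" unfolding C_def by (rule adapted_sets[OF adapted_covered])
  have Rs': "{\<omega> \<in> space M. \<forall>t. visits (path \<omega>) t v < k} \<in> sets M" for v
    by (intro sets.sets_Collect_countable_All adapted_sets[OF adapted_comp[OF adapted_visits]])
  have Rs: "R \<in> sets M" unfolding R_def using Rs' by (intro sets.finite_UN) auto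
  have nl: "adapted (Suc t) (\<lambda>x. x (Suc t) = x t)" for t by (rule adaptedI) auto
  have Ns: "N \<in> sets M" unfolding N_def
    by (intro sets.sets_Collect_countable_Ex adapted_sets[OF nl])
  have Us: "U \<in> sets M" "U' \<in> sets M"
    unfolding U_def U'_def using E1s finite_separating_pairs by (auto intro!: sets.finite_UN)
  have Ws: "W a \<in> sets M" for a
    unfolding W_def using E2s finite_separating_pairs by (auto intro!: sets.finite_UN)
  \<comment> \<open>Off the bad events the trajectory satisfies every hypothesis of the
    deterministic part.\<close>
  have cover: "space M \<subseteq> G \<union> (C \<union> (R \<union> (N \<union> (U \<union> (U' \<union> (\<Union>a\<in>{2..n}. W a))))))"
  proof
    fix \<omega> assume \<omega>: "\<omega> \<in> space M"
    show "\<omega> \<in> G \<union> (C \<union> (R \<union> (N \<union> (U \<union> (U' \<union> (\<Union>a\<in>{2..n}. W a))))))"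
    proof (rule ccontr)
      assume "\<not> ?thesis"
      then have negs: "\<omega> \<notin> G" "\<omega> \<notin> C" "\<omega> \<notin> R" "\<omega> \<notin> N" "\<omega> \<notin> U" "\<omega> \<notin> U'" "\<omega> \<notin> (\<Union>a\<in>{2..n}. W a)"
        by simp_all
      have "tau_C n k (path \<omega>) = tau_delta n (2 * k - 1) (path \<omega>) \<and>
        tau_delta n (2 * k - 1) (path \<omega>) = tau_kappa n (2 * k - 1) (path \<omega>) \<and>
        tau_C n k (path \<omega>) + 1 = tau_delta n (2 * k) (path \<omega>) \<and>
        tau_delta n (2 * k) (path \<omega>) = tau_kappa n (2 * k) (path \<omega>)"
      proof (rule hitting_times_coincide_if_not_separated[OF k, of n "path \<omega>" u])
        show "2 * k < n" using nk k by simp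
        show "path \<omega> i \<in> {1..n}" for i using \<omega> by (rule X_range)
        show "path \<omega> (Suc i) \<noteq> path \<omega> i" for i using negs(4) \<omega> unfolding N_def by blast
        show "\<not> (\<forall>v\<in>{1..n}. \<exists>i\<le>u. path \<omega> i = v)" using negs(2) \<omega> unfolding C_def by blast
        show "\<exists>t. k \<le> visits (path \<omega>) t v" if "v \<in> {1..n}" for v
          using negs(3) \<omega> that unfolding R_def not_less[symmetric] by blast
      next
        fix A S t
        assume *: "u \<le> t" "A \<subseteq> {1..n}" "S \<subseteq> {1..n}" "A \<inter> S = {}" "card A = 1" "card S \<le> 2 * k - 2"
          "separated A S (path \<omega>) t"
        then have "(A, S) \<in> separating_pairs n 1 (2 * k - 2)"
          using nk k by (simp add: separating_pairs_def)
        moreover have "4 * m / n \<le> potential A S (4 * m / n) (1 + 1 / (8 * m)) (X t \<omega>)"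
        proof -
          have "4 * m / n \<le> 1" using m n3 by simp
          moreover have "(1::real) \<le> 1 + 1 / (8 * m)" using m by simp
          ultimately have "4 * m / n \<le> 1 + 1 / (8 * m)" by (rule order_trans)
          with \<open>4 * m / n \<le> 1\<close> show ?thesis by (auto simp: potential_def)
        qed
        ultimately have "\<omega> \<in> U" if "k \<le> set_visits A (path \<omega>) t"
          unfolding U_def E1_def using * that \<omega> by blast
        then show "\<not> k \<le> set_visits A (path \<omega>) t" using negs(5) by blast
      next
        fix A S t
        assume *: "u \<le> t" "A \<subseteq> {1..n}" "S \<subseteq> {1..n}" "A \<inter> S = {}" "card A = 1" "card S \<le> 2 * k - 1"
          "separated A S (path \<omega>) t" "path \<omega> t \<notin> A"
        then have "(A, S) \<in> separating_pairs n 1 (2 * k - 1)"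
          using nk k by (simp add: separating_pairs_def)
        moreover have "1 \<le> potential A S (4 * m / n) (1 + 1 / (8 * m)) (X t \<omega>)"
          using *(8) m by (auto simp: potential_def)
        ultimately have "\<omega> \<in> U'" if "k \<le> set_visits A (path \<omega>) t"
          unfolding U'_def E1_def using * that \<omega> by blast
        then show "\<not> k \<le> set_visits A (path \<omega>) t" using negs(6) by blast
      next
        fix A S t
        assume *: "u \<le> t" "A \<subseteq> {1..n}" "S \<subseteq> {1..n}" "A \<inter> S = {}" "2 \<le> card A" "2 * card A + card S \<le> n"
          "card S \<le> 2 * k - 1" "separated A S (path \<omega>) t"
        then have "(A, S) \<in> separating_pairs n (card A) (2 * k - 1)" by (simp add: separating_pairs_def)
        then have "\<omega> \<in> W (card A)" if "k * card A \<le> set_visits A (path \<omega>) t"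
          unfolding W_def E2_def using * that \<omega> by blast
        moreover have "card A \<in> {2..n}" using * by simp
        ultimately show "\<not> k * card A \<le> set_visits A (path \<omega>) t" using negs(7) by blast
      qed
      then show False using negs(1) \<omega> unfolding G_def by blast
    qed
  qed
  have pC: "prob C \<le> exp ((w + 1) * (1 / (real n - 1) + 2 * (1 / (real n - 1))\<^sup>2)) / (real n - 1)"
    unfolding C_def w_def by (rule prob_covered_early_le[OF n3]) (use u in \<open>simp add: w_def\<close>)
  have pR: "prob R = 0"
  proof -
    have "prob R \<le> (\<Sum>v\<in>{1..n}. prob {\<omega> \<in> space M. \<forall>t. visits (path \<omega>) t v < k})"
      unfolding R_def using Rs' by (intro finite_measure_subadditive_finite) auto
    also have "\<dots> = 0" by (intro sum.neutral ballI prob_visits_bounded)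
    finally show ?thesis by (simp add: measure_le_0_iff)
  qed
  have pN: "prob N = 0" unfolding N_def by (rule prob_no_loops)
  have \<epsilon>8: "\<epsilon> \<le> 1/8" using \<epsilon>1 by simp
  have pU: "prob U \<le> 3 * 2 ^ (2 * k - 1) * (64 * (2 * real k - 1)\<^sup>2) ^ k * real n powr (- 3/4)"
    unfolding U_def
  proof (rule order_trans[OF prob_Union_separating_pairs_le singles_bound(2)[OF k n1]])
    fix A S assume *: "A \<subseteq> {1..n}" "S \<subseteq> {1..n}" "A \<inter> S = {}" "card A = 1" "card S \<le> 2 * k - 2"
    then show "prob (E1 (4 * m / n) A S) \<le> real n powr (- 3/4) * 3 /
        (((real n)\<^sup>2 / (64 * (2 * real k - 1)\<^sup>2)) ^ k * (4 * (2 * real k - 1) / n))"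
      unfolding E1_def m_def
      by (intro prob_single_separated_le[OF k nk \<epsilon>8]) (use u m n3 in \<open>auto simp: w_def m_def\<close>)
  qed (use E1s m in \<open>auto simp: m_def\<close>)
  have pU': "prob U' \<le> 3 * 2 ^ (2 * k - 1) * (64 * (2 * real k - 1)\<^sup>2) ^ k * real n powr (- 3/4)"
    unfolding U'_def
  proof (rule order_trans[OF prob_Union_separating_pairs_le singles_bound(1)[OF k n1]])
    fix A S assume *: "A \<subseteq> {1..n}" "S \<subseteq> {1..n}" "A \<inter> S = {}" "card A = 1" "card S \<le> 2 * k - 1"
    then show "prob (E1 1 A S) \<le> real n powr (- 3/4) * 3 /
        (((real n)\<^sup>2 / (64 * (2 * real k - 1)\<^sup>2)) ^ k * 1)"
      unfolding E1_def m_def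
      by (intro prob_single_separated_le[OF k nk \<epsilon>8]) (use u in \<open>auto simp: w_def\<close>)
  qed (use E1s m in \<open>auto simp: m_def\<close>)
  define K2 where "K2 = 3 * 2 ^ (2 * k - 1) * real n powr (- 5/8)"
  define K3 where "K3 = 4 * 2 ^ (2 * k - 1) * real n powr (- 2)"
  have pW: "prob (W a) \<le> (if real a \<le> real n powr (2 * \<epsilon>) then K2 else K3)" if a: "2 \<le> a" for a
  proof (cases "real a \<le> real n powr (2 * \<epsilon>)")
    case True
    have "real (32 * k * a) \<le> 32 * real k * real n powr (2 * \<epsilon>)" using True by (simp add: mult_left_mono)
    with n(3) have a': "32 * k * a \<le> n" by linarith
    have "prob (W a) \<le> K2"
      unfolding W_def K2_def
    proof (rule order_trans[OF prob_Union_separating_pairs_le small_sets_bound[OF k \<epsilon> n1 n(2) a True]])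
      fix A S assume *: "A \<subseteq> {1..n}" "S \<subseteq> {1..n}" "A \<inter> S = {}" "card A = a" "card S \<le> 2 * k - 1"
      show "prob (E2 A S) \<le> real n powr (- ((a - 1/8) * (1 - \<epsilon>))) * 3 / (real n / (16 * (2 * real k - 1) * a)) ^ (k * a)"
        unfolding E2_def *(4)[symmetric]
        by (rule prob_small_separated_le[OF k nk _ *(1-3) _ _ *(5)]) (use u a a' *(4) in \<open>auto simp: w_def\<close>)
    qed (use E2s m in \<open>auto simp: m_def\<close>)
    with True show ?thesis by simp
  next
    case False
    then have a': "real n powr (2 * \<epsilon>) \<le> real a" by simp
    have "prob (W a) \<le> K3"
      unfolding W_def K3_def
    proof (rule order_trans[OF prob_Union_separating_pairs_le large_sets_bound[OF k _ _ n1 n(5,6) a']])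
      fix A S assume *: "A \<subseteq> {1..n}" "S \<subseteq> {1..n}" "A \<inter> S = {}" "card A = a" "card S \<le> 2 * k - 1"
        "2 * a + card S \<le> n"
      show "prob (E2 A S) \<le> real n powr (- ((real a - 2 * (2 * real k - 1)) * (1 - \<epsilon>))) * 4"
        unfolding E2_def *(4)[symmetric]
        by (rule prob_large_separated_le[OF k _ *(1-3) _ _ *(5)]) (use u a' n(4) *(4,6) in \<open>auto simp: w_def\<close>)
    qed (use E2s \<epsilon>1 in auto)
    with False show ?thesis by simp
  qed
  \<comment> \<open>At most n^(2 eps) sizes are small, so \<open>K2\<close> is counted that often;
    \<open>K3\<close> is simply added for every size.\<close>
  have "(\<Sum>a\<in>{2..n}. prob (W a)) \<le> (\<Sum>a\<in>{2..n}. if real a \<le> real n powr (2 * \<epsilon>) then K2 else K3)"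
    by (intro sum_mono pW) auto
  also have "\<dots> \<le> (\<Sum>a\<in>{2..n}. (if real a \<le> real n powr (2 * \<epsilon>) then K2 else 0) + K3)"
    by (intro sum_mono) (auto simp: K2_def K3_def)
  also have "\<dots> = (\<Sum>a\<in>{2..n}. if real a \<le> real n powr (2 * \<epsilon>) then K2 else 0) + real (n - 1) * K3"
    by (simp add: sum.distrib)
  also have "\<dots> \<le> real n powr (2 * \<epsilon>) * K2 + real n * K3"
  proof (intro add_mono mult_right_mono)
    have "(\<Sum>a\<in>{2..n}. if real a \<le> real n powr (2 * \<epsilon>) then K2 else 0)
        = card {a \<in> {2..n}. real a \<le> real n powr (2 * \<epsilon>)} * K2"
      by (subst sum.inter_filter[symmetric]) auto
    also have "\<dots> \<le> real n powr (2 * \<epsilon>) * K2"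
    proof (intro mult_right_mono)
      have "card {a \<in> {2..n}. real a \<le> real n powr (2 * \<epsilon>)} \<le> card {1..nat \<lfloor>real n powr (2 * \<epsilon>)\<rfloor>}"
        by (intro card_mono) (auto simp: le_nat_floor)
      then have "card {a \<in> {2..n}. real a \<le> real n powr (2 * \<epsilon>)} \<le> nat \<lfloor>real n powr (2 * \<epsilon>)\<rfloor>"
        by (simp only: card_atLeastAtMost diff_Suc_1)
      then have "real (card {a \<in> {2..n}. real a \<le> real n powr (2 * \<epsilon>)}) \<le> real (nat \<lfloor>real n powr (2 * \<epsilon>)\<rfloor>)"
        by (rule of_nat_mono)
      also have "\<dots> \<le> real n powr (2 * \<epsilon>)" by (rule of_nat_floor) simp
      finally show "real (card {a \<in> {2..n}. real a \<le> real n powr (2 * \<epsilon>)}) \<le> real n powr (2 * \<epsilon>)" .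
    qed (simp add: K2_def)
    finally show "(\<Sum>a\<in>{2..n}. if real a \<le> real n powr (2 * \<epsilon>) then K2 else 0) \<le> real n powr (2 * \<epsilon>) * K2" .
  qed (auto simp: K3_def)
  finally have sumW: "(\<Sum>a\<in>{2..n}. prob (W a)) \<le> real n powr (2 * \<epsilon>) * K2 + real n * K3" .
  have Wn: "(\<Union>a\<in>{2..n}. W a) \<in> sets M" using Ws by (intro sets.finite_UN) auto
  have pWs: "prob (\<Union>a\<in>{2..n}. W a) \<le> (\<Sum>a\<in>{2..n}. prob (W a))"
    using Ws by (intro finite_measure_subadditive_finite) auto
  have "1 = prob (space M)" by (simp add: prob_space)
  also have "\<dots> \<le> prob (G \<union> (C \<union> (R \<union> (N \<union> (U \<union> (U' \<union> (\<Union>a\<in>{2..n}. W a)))))))"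
    by (intro finite_measure_mono cover sets.Un Gs Cs Rs Ns Us Wn)
  also have "\<dots> \<le> prob G + (prob C + (prob R + (prob N + (prob U + (prob U' + prob (\<Union>a\<in>{2..n}. W a))))))"
    by (intro order_trans[OF measure_Un_le] add_left_mono sets.Un Gs Cs Rs Ns Us Wn order_refl)
  finally show ?thesis
    using pC pR pN pU pU' pWs sumW unfolding G_def[symmetric] w_def[symmetric] K2_def[symmetric] K3_def[symmetric]
    by linarith
qed

end

section \<open>Passage to the limit\<close>

theorem theorem4:
  fixes k :: nat and M :: "nat \<Rightarrow> 'a measure" and X :: "nat \<Rightarrow> nat \<Rightarrow> 'a \<Rightarrow> nat"
  assumes "1 \<le> k"
    and "\<And>n. 2 \<le> n \<Longrightarrow> complete_graph_walk (M n) n (X n)"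
  shows "(\<lambda>n. \<P>(\<omega> in M n.
      tau_C n k (\<lambda>t. X n t \<omega>) = tau_delta n (2 * k - 1) (\<lambda>t. X n t \<omega>) \<and>
      tau_delta n (2 * k - 1) (\<lambda>t. X n t \<omega>) = tau_kappa n (2 * k - 1) (\<lambda>t. X n t \<omega>) \<and>
      tau_C n k (\<lambda>t. X n t \<omega>) + 1 = tau_delta n (2 * k) (\<lambda>t. X n t \<omega>) \<and>
      tau_delta n (2 * k) (\<lambda>t. X n t \<omega>) = tau_kappa n (2 * k) (\<lambda>t. X n t \<omega>)))
    \<longlonglongrightarrow> 1"
proof -
  define \<epsilon> where "\<epsilon> = 1 / (32 * real k)"
  have \<epsilon>: "0 < \<epsilon>" "\<epsilon> \<le> 1/32" using assms(1) by (auto simp: \<epsilon>_def field_simps)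
  define F where "F = (\<lambda>n::nat. 1 - (exp (((1 - \<epsilon>) * (real n - 1) * ln n + 1) * (1 / (real n - 1) + 2 * (1 / (real n - 1))\<^sup>2)) / (real n - 1)
      + 2 * (3 * 2 ^ (2 * k - 1) * (64 * (2 * real k - 1)\<^sup>2) ^ k * real n powr (- 3/4))
      + (real n powr (2 * \<epsilon>) * (3 * 2 ^ (2 * k - 1) * real n powr (- 5/8)) + n * (4 * 2 ^ (2 * k - 1) * real n powr (- 2)))))"
  \<comment> \<open>The exponential is of order n^(1 - eps), so the early cover term vanishes like
    n^(-eps).\<close>
  have t1: "(\<lambda>n. exp (((1 - \<epsilon>) * (real n - 1) * ln n + 1) * (1 / (real n - 1) + 2 * (1 / (real n - 1))\<^sup>2)) / (real n - 1)) \<longlonglongrightarrow> 0"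
    using \<epsilon> by real_asymp
  have t2: "(\<lambda>n. real n powr (- 3/4)) \<longlonglongrightarrow> 0" by real_asymp
  \<comment> \<open>Here 2 eps <= 1/16, so the number of small sizes does not outweigh the bound
    n^(-5/8) for each of them.\<close>
  have t3: "(\<lambda>n. real n powr (2 * \<epsilon>) * real n powr (- 5/8)) \<longlonglongrightarrow> 0"
  proof -
    have "(\<lambda>n. real n powr (2 * \<epsilon> + - 5/8)) \<longlonglongrightarrow> 0"
      using \<epsilon> by (intro tendsto_neg_powr filterlim_real_sequentially) auto
    then show ?thesis by (simp only: powr_add)
  qed
  have t4: "(\<lambda>n. real n * real n powr (- 2)) \<longlonglongrightarrow> 0" by real_asymp
  have F: "F \<longlonglongrightarrow> 1"
  proof -
    have "(\<lambda>n::nat. 1 - (exp (((1 - \<epsilon>) * (real n - 1) * ln n + 1) * (1 / (real n - 1) + 2 * (1 / (real n - 1))\<^sup>2)) / (real n - 1)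
      + 2 * (3 * 2 ^ (2 * k - 1) * (64 * (2 * real k - 1)\<^sup>2) ^ k * real n powr (- 3/4))
      + ((3 * 2 ^ (2 * k - 1)) * (real n powr (2 * \<epsilon>) * real n powr (- 5/8)) + (4 * 2 ^ (2 * k - 1)) * (real n * real n powr (- 2)))))
      \<longlonglongrightarrow> 1 - (0 + 2 * (3 * 2 ^ (2 * k - 1) * (64 * (2 * real k - 1)\<^sup>2) ^ k * 0) + ((3 * 2 ^ (2 * k - 1)) * 0 + (4 * 2 ^ (2 * k - 1)) * 0))"
      by (intro tendsto_intros t1 t2 t3 t4)
    then show ?thesis unfolding F_def by (simp only: mult_zero_right add_0_left add_0_right diff_zero) (simp only: mult_ac)
  qed
  have p: "filterlim (\<lambda>n. real n powr c) at_top sequentially" if "0 < c" for c :: real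
    using that by real_asymp
  have "\<forall>\<^sub>F n in sequentially. 16 * (2 * real k - 1) \<le> real n powr \<epsilon>"
    using p[of \<epsilon>] \<epsilon> by (simp add: filterlim_at_top)
  moreover have "\<forall>\<^sub>F n in sequentially. 4 * real k \<le> real n powr (2 * \<epsilon>)"
    using p[of "2 * \<epsilon>"] \<epsilon> by (simp add: filterlim_at_top)
  moreover have "\<forall>\<^sub>F n in sequentially. (6 * real k + 2) * 2 / \<epsilon> \<le> real n powr (2 * \<epsilon>)"
    using p[of "2 * \<epsilon>"] \<epsilon> by (simp add: filterlim_at_top)
  moreover have "\<forall>\<^sub>F n in sequentially. 32 * real k * real n powr (2 * \<epsilon>) \<le> n"
  proof -
    have "\<forall>\<^sub>F n in sequentially. 32 * real k \<le> real n powr (1 - 2 * \<epsilon>)"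
      using p[of "1 - 2 * \<epsilon>"] \<epsilon> by (simp add: filterlim_at_top)
    with eventually_gt_at_top[of 0] show ?thesis
      by eventually_elim (simp add: powr_diff field_simps)
  qed
  moreover have "\<forall>\<^sub>F n in sequentially. 2 \<le> \<epsilon> * ln (real n)"
  proof -
    have "filterlim (\<lambda>n. \<epsilon> * ln (real n)) at_top sequentially" using \<epsilon> by real_asymp
    then show ?thesis by (simp add: filterlim_at_top)
  qed
  moreover have "\<forall>\<^sub>F n in sequentially. 16 * real k \<le> real n"
    using filterlim_real_sequentially by (simp add: filterlim_at_top)
  moreover have "\<forall>\<^sub>F n in sequentially. 2 \<le> n" by (rule eventually_ge_at_top)
  ultimately have lower: "\<forall>\<^sub>F n in sequentially. F n \<le> \<P>(\<omega> in M n.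
      tau_C n k (\<lambda>t. X n t \<omega>) = tau_delta n (2 * k - 1) (\<lambda>t. X n t \<omega>) \<and>
      tau_delta n (2 * k - 1) (\<lambda>t. X n t \<omega>) = tau_kappa n (2 * k - 1) (\<lambda>t. X n t \<omega>) \<and>
      tau_C n k (\<lambda>t. X n t \<omega>) + 1 = tau_delta n (2 * k) (\<lambda>t. X n t \<omega>) \<and>
      tau_delta n (2 * k) (\<lambda>t. X n t \<omega>) = tau_kappa n (2 * k) (\<lambda>t. X n t \<omega>))"
  proof eventually_elim
    case (elim n)
    show ?case unfolding F_def
      by (rule complete_graph_walk.prob_not_coincide_le[OF assms(2)[OF elim(7)] assms(1) \<epsilon>_def elim(6,1,4,2,5,3)])
  qed
  show ?thesis
  proof (rule tendsto_sandwich[OF lower _ F tendsto_const])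
    show "\<forall>\<^sub>F n in sequentially. \<P>(\<omega> in M n.
      tau_C n k (\<lambda>t. X n t \<omega>) = tau_delta n (2 * k - 1) (\<lambda>t. X n t \<omega>) \<and>
      tau_delta n (2 * k - 1) (\<lambda>t. X n t \<omega>) = tau_kappa n (2 * k - 1) (\<lambda>t. X n t \<omega>) \<and>
      tau_C n k (\<lambda>t. X n t \<omega>) + 1 = tau_delta n (2 * k) (\<lambda>t. X n t \<omega>) \<and>
      tau_delta n (2 * k) (\<lambda>t. X n t \<omega>) = tau_kappa n (2 * k) (\<lambda>t. X n t \<omega>)) \<le> 1"
      using eventually_ge_at_top[of 2]
    proof eventually_elim
      case (elim n)
      interpret complete_graph_walk "M n" n "X n" using assms(2)[OF elim] .
      show ?case by (rule prob_le_1)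
    qed
  qed
qed

end
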